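(* Let $G$ be a countably infinite discrete group and let $X$ be a Borel $G$-space. If $X$ admits a locally finitely traveling Borel complete section, then $X$ admits a Borel $32$-generator.
   Context: A Borel $G$-space is a standard Borel space $X$ equipped with a Borel action of $G$; $[x]_G$ denotes the orbit of $x$. A complete section is a subset of $X$ meeting every orbit. A $k$-generator for $X$ is a partition $\{A_n\}_{n<k}$ of $X$ into Borel sets (pieces may be empty) such that $\{gA_n : g\in G, n<k\}$ generates the Borel $\sigma$-algebra of $X$. Borel sets $A,B\subseteq X$ are locally finitely equidecomposable, written $A\sim_{\mathrm{lfin}}B$, if there are $N\le\infty$, elements $\{g_n\}_{n<N}\subseteq G$ and Borel partitions $\{A_n\}_{n<N}$ of $A$ and $\{B_n\}_{n<N}$ of $B$ such that $g_nA_n=B_n$ for all $n<N$ and, for every $x\in A$, $A_n\cap[x]_G=\emptyset$ for all but finitely many $n<N$. A Borel set $A\subseteq X$ is locally finitely traveling if there are pairwise disjoint Borel sets $\{A_n\}_{n\in\mathbb{N}}$ with $A_0=A$ and $A\sim_{\mathrm{lfin}}A_n$ for all $n\in\mathbb{N}$. *)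

theory Defs
  imports "HOL-Analysis.Analysis" "HOL-Algebra.Group_Action" "HOL-Library.Extended_Nat"
begin

text \<open>
  A standard Borel space is represented by a \<open>measure\<close> of which only the carrier
  \<^term>\<open>space M\<close> and the sigma-algebra \<^term>\<open>sets M\<close> are used: the sigma-algebra has to
  be the one generated by the open sets of some Polish topology on the carrier.
\<close>

definition polish_topology :: "'a topology \<Rightarrow> bool" where
  "polish_topology T \<longleftrightarrow> separable_space T \<and> completely_metrizable_space T"

definition standard_borel :: "'a measure \<Rightarrow> bool" where
  "standard_borel M \<longleftrightarrow>
     (\<exists>T. polish_topology T \<and> topspace T = space M
        \<and> sets M = sigma_sets (space M) {U. openin T U})"

text \<open>
  The acting group \<open>G\<close> is discrete, so for countable \<open>G\<close> its Borel sigma-algebra is the full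
  powerset, \<^term>\<open>count_space (carrier G)\<close>. The action is Borel if the map
  \<open>(g, x) \<mapsto> g x\<close> from \<open>G \<times> X\<close> to \<open>X\<close> is.
\<close>

definition borel_G_space ::
    "('g, 'm) monoid_scheme \<Rightarrow> 'a measure \<Rightarrow> ('g \<Rightarrow> 'a \<Rightarrow> 'a) \<Rightarrow> bool" where
  "borel_G_space G M \<phi> \<longleftrightarrow>
     standard_borel M \<and> group_action G (space M) \<phi>
     \<and> (\<lambda>(g, x). \<phi> g x) \<in> measurable (count_space (carrier G) \<Otimes>\<^sub>M M) M"

definition complete_section ::
    "('g, 'm) monoid_scheme \<Rightarrow> 'a measure \<Rightarrow> ('g \<Rightarrow> 'a \<Rightarrow> 'a) \<Rightarrow> 'a set \<Rightarrow> bool" where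
  "complete_section G M \<phi> A \<longleftrightarrow>
     A \<subseteq> space M \<and> (\<forall>x\<in>space M. A \<inter> orbit G \<phi> x \<noteq> {})"

text \<open>Partitions are indexed families; pieces may be empty.\<close>

definition borel_partition :: "'a measure \<Rightarrow> 'i set \<Rightarrow> ('i \<Rightarrow> 'a set) \<Rightarrow> 'a set \<Rightarrow> bool" where
  "borel_partition M I P A \<longleftrightarrow>
     (\<forall>i\<in>I. P i \<in> sets M) \<and> disjoint_family_on P I \<and> (\<Union>i\<in>I. P i) = A"

definition generator ::
    "('g, 'm) monoid_scheme \<Rightarrow> 'a measure \<Rightarrow> ('g \<Rightarrow> 'a \<Rightarrow> 'a) \<Rightarrow> nat \<Rightarrow> (nat \<Rightarrow> 'a set) \<Rightarrow> bool" where
  "generator G M \<phi> k P \<longleftrightarrow>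
     borel_partition M {..<k} P (space M)
     \<and> sigma_sets (space M) {\<phi> g ` P n | g n. g \<in> carrier G \<and> n < k} = sets M"

text \<open>The number \<open>N\<close> of pieces is finite or countably infinite.\<close>

definition lfin_equidecomposable ::
    "('g, 'm) monoid_scheme \<Rightarrow> 'a measure \<Rightarrow> ('g \<Rightarrow> 'a \<Rightarrow> 'a) \<Rightarrow> 'a set \<Rightarrow> 'a set \<Rightarrow> bool" where
  "lfin_equidecomposable G M \<phi> A B \<longleftrightarrow>
     A \<in> sets M \<and> B \<in> sets M \<and>
     (\<exists>(N::enat) g P Q.
        (\<forall>n. enat n < N \<longrightarrow> g n \<in> carrier G)
        \<and> borel_partition M {n. enat n < N} P A
        \<and> borel_partition M {n. enat n < N} Q B
        \<and> (\<forall>n. enat n < N \<longrightarrow> \<phi> (g n) ` P n = Q n)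
        \<and> (\<forall>x\<in>A. finite {n. enat n < N \<and> P n \<inter> orbit G \<phi> x \<noteq> {}}))"

definition lfin_traveling ::
    "('g, 'm) monoid_scheme \<Rightarrow> 'a measure \<Rightarrow> ('g \<Rightarrow> 'a \<Rightarrow> 'a) \<Rightarrow> 'a set \<Rightarrow> bool" where
  "lfin_traveling G M \<phi> A \<longleftrightarrow>
     A \<in> sets M \<and>
     (\<exists>S :: nat \<Rightarrow> 'a set.
        (\<forall>n. S n \<in> sets M) \<and> disjoint_family S \<and> S 0 = A
        \<and> (\<forall>n. lfin_equidecomposable G M \<phi> A (S n)))"

end

(* Fix a Borel set F. A greedy back-and-forth over an enumeration of G fills a Borel set Y with
   as many disjoint copies of F as possible, orbit by orbit; if m copies fit and the next one does
   not, then m + 1 copies of F cover Y. The number m (the "level" of Y) behaves like a finitely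
   additive invariant measure up to bounded errors. Wherever it is infinite or one of these
   approximate rules fails, some set contains more copies of F than needed to cover it, which
   compresses it: there are a complete section D and disjoint injective images T_n(D), all
   definable from three Borel sets and their translates. Then the union over n of the T_n(D \<inter> U_n), for U_n
   a countable base, codes every Borel set, so that four sets (16 pieces) generate.
   On an orbit where all the rules hold, a locally finitely traveling section A has many disjoint copies
   of nearly the same level inside a space covered by boundedly many copies of A; this bounds the level of A
   with respect to F independently of F, which is absurd, as F can be chosen with arbitrarily many
   disjoint translates inside A. *)

theory Submission
  imports Defs
begin

section \<open>Invariant sigma-algebras\<close>

text \<open>A locally finite equidecomposition of \<open>A\<close> with \<open>S n\<close> may have
  infinitely many pieces, so compressing \<open>A\<close> directly along it would put unboundedly
  many sets into the generating family. Levels avoid this: they are carried through the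
  equidecomposition one rule at a time, and each rule compares at most two sets by means of one
  measuring set \<open>F\<close>. Where it fails, these three sets already describe a compression.
  The rules have additive errors, and an infinite sum of errors would be worthless; local finiteness
  makes the sum finite on every orbit. Countably many rules give countably many exceptional regions,
  each with its own triple of sets. As coding is a property of whole orbits, the triples can be
  merged into a single one. Marking the regions costs no further set: the locus where a system of
  maps codes correctly is computed from the system itself. One more set carries the code.\<close>

lemma standard_borel_countable_base:
  assumes "standard_borel M"
  obtains U :: "nat \<Rightarrow> 'a set"
  where "sets M = sigma_sets (space M) (range U)" "\<And>n. U n \<in> sets M"
    "\<And>x y. \<lbrakk>x \<in> space M; y \<in> space M; x \<noteq> y\<rbrakk> \<Longrightarrow> \<exists>n. x \<in> U n \<and> y \<notin> U n"
proof -
  obtain T where T: "separable_space T" "completely_metrizable_space T" "topspace T = space M"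
    and sM: "sets M = sigma_sets (space M) {U. openin T U}"
    using assms unfolding standard_borel_def polish_topology_def by blast
  obtain S d where "Metric_space S d" and Tm: "T = Metric_space.mtopology S d"
    using T(2) unfolding completely_metrizable_space_def by blast
  then interpret Metric_space S d by simp
  have S: "S = space M" using T(3) Tm by simp
  obtain C where C: "countable C" "C \<subseteq> S" "T closure_of C = topspace T"
    using T(1) S T(3) unfolding separable_space_def by auto
  \<comment> \<open>The inserted empty set keeps the base nonempty even over an empty space, as its
    enumeration by \<open>from_nat_into\<close> requires.\<close>
  define \<B> where "\<B> = insert {} ((\<lambda>(c, k). mball c (1 / real (Suc k))) ` (C \<times> UNIV))"
  have \<B>c: "countable \<B>" unfolding \<B>_def using C(1) by auto
  have \<B>o: "openin T B" if "B \<in> \<B>" for B using that unfolding \<B>_def Tm by auto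
  have nbhd: "\<exists>B\<in>\<B>. x \<in> B \<and> B \<subseteq> V" if V: "openin T V" "x \<in> V" for V x
  proof -
    have xS: "x \<in> S" using V openin_subset T(3) S by blast
    obtain r where r: "r > 0" "mball x r \<subseteq> V"
      using V unfolding Tm openin_mtopology by blast
    obtain k where k: "1 / real (Suc k) < r / 2"
      using reals_Archimedean[of "r/2"] r(1) by (auto simp: inverse_eq_divide)
    have "x \<in> T closure_of C" using xS C(3) T(3) S by simp
    moreover have "openin T (mball x (1 / real (Suc k)))" unfolding Tm by simp
    moreover have "x \<in> mball x (1 / real (Suc k))" using xS by simp
    ultimately obtain c where c: "c \<in> C" "c \<in> mball x (1 / real (Suc k))"
      unfolding in_closure_of by blast
    have "mball c (1 / real (Suc k)) \<subseteq> mball x r"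
    proof
      fix y assume y: "y \<in> mball c (1 / real (Suc k))"
      have "d x y \<le> d x c + d c y" using xS c y by (intro triangle) auto
      also have "\<dots> < r" using c y k by simp
      finally show "y \<in> mball x r" using xS y by simp
    qed
    moreover have "x \<in> mball c (1 / real (Suc k))" using c by (auto simp: commute)
    moreover have "mball c (1 / real (Suc k)) \<in> \<B>" unfolding \<B>_def using c(1) by auto
    ultimately show ?thesis using r(2) by blast
  qed
  have "\<B> \<noteq> {}" unfolding \<B>_def by simp
  then have rg: "range (from_nat_into \<B>) = \<B>" using \<B>c by (rule range_from_nat_into)
  show ?thesis
  proof (rule that[of "from_nat_into \<B>"])
    show "sets M = sigma_sets (space M) (range (from_nat_into \<B>))"
      unfolding rg sM
    proof (rule sigma_sets_eqI)
      fix V assume "V \<in> {U. openin T U}"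
      then have "V = \<Union>{B \<in> \<B>. B \<subseteq> V}" using nbhd by blast
      moreover have "countable {B \<in> \<B>. B \<subseteq> V}" using \<B>c by simp
      ultimately show "V \<in> sigma_sets (space M) \<B>"
        by (metis (no_types, lifting) mem_Collect_eq sigma_sets.Basic sigma_sets_UNION)
    qed (use \<B>o in blast)
    show "from_nat_into \<B> n \<in> sets M" for n
      using \<B>o rg sM by (metis mem_Collect_eq rangeI sigma_sets.Basic)
    show "\<exists>n. x \<in> from_nat_into \<B> n \<and> y \<notin> from_nat_into \<B> n"
      if xy: "x \<in> space M" "y \<in> space M" "x \<noteq> y" for x y
    proof -
      have "d x y > 0" using xy S by simp
      moreover have "openin T (mball x (d x y))" unfolding Tm by simp
      moreover have "x \<in> mball x (d x y)" using xy(1) \<open>d x y > 0\<close> unfolding S[symmetric] in_mball by simp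
      ultimately obtain B where "B \<in> \<B>" "x \<in> B" "B \<subseteq> mball x (d x y)"
        using nbhd by blast
      then show ?thesis using rg by (metis (no_types, lifting) image_iff in_mball less_irrefl subsetD)
    qed
  qed
qed

section \<open>Orbits, translates and sigma-algebras closed under the action\<close>

locale borel_action =
  fixes G :: "('g, 'm) monoid_scheme" (structure)
    and X :: "'a measure"
    and \<phi> :: "'g \<Rightarrow> 'a \<Rightarrow> 'a"
  assumes grp: "group G"
    and cnt: "countable (carrier G)"
    and space: "borel_G_space G X \<phi>"
begin

sublocale group G by (rule grp)
sublocale act: group_action G "space X" \<phi>
  using space unfolding borel_G_space_def by blast

abbreviation \<Omega> :: "'a set" where "\<Omega> \<equiv> space X"
abbreviation orb :: "'a \<Rightarrow> 'a set" where "orb \<equiv> orbit G \<phi>"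

lemma act_in [simp]: "g \<in> carrier G \<Longrightarrow> x \<in> \<Omega> \<Longrightarrow> \<phi> g x \<in> \<Omega>"
  using act.element_image by blast

lemma act_mult: "\<lbrakk>g \<in> carrier G; h \<in> carrier G; x \<in> \<Omega>\<rbrakk> \<Longrightarrow> \<phi> (g \<otimes> h) x = \<phi> g (\<phi> h x)"
  using act.composition_rule by blast

lemma act_one [simp]: "x \<in> \<Omega> \<Longrightarrow> \<phi> \<one> x = x"
  using act.id_eq_one by (metis restrict_apply')

lemma act_inv [simp]: "\<lbrakk>g \<in> carrier G; x \<in> \<Omega>\<rbrakk> \<Longrightarrow> \<phi> (inv g) (\<phi> g x) = x"
  using act.orbit_sym_aux by blast

lemma act_inv' [simp]: "\<lbrakk>g \<in> carrier G; x \<in> \<Omega>\<rbrakk> \<Longrightarrow> \<phi> g (\<phi> (inv g) x) = x"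
  using act_inv[of "inv g" x] by simp

lemma mem_act_image:
  "\<lbrakk>g \<in> carrier G; A \<subseteq> \<Omega>\<rbrakk> \<Longrightarrow> y \<in> \<phi> g ` A \<longleftrightarrow> y \<in> \<Omega> \<and> \<phi> (inv g) y \<in> A"
proof -
  assume g: "g \<in> carrier G" and A: "A \<subseteq> \<Omega>"
  have "\<phi> (inv g) y \<in> A" "y \<in> \<Omega>" if y: "y \<in> \<phi> g ` A"
  proof -
    obtain x where "x \<in> A" "y = \<phi> g x" using y by blast
    then show "\<phi> (inv g) y \<in> A" "y \<in> \<Omega>" using A g by auto
  qed
  moreover have "y \<in> \<phi> g ` A" if "y \<in> \<Omega>" "\<phi> (inv g) y \<in> A"
    using that g by (intro image_eqI[of y "\<phi> g" "\<phi> (inv g) y"]) auto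
  ultimately show ?thesis by blast
qed

lemma mem_act_image_inv:
  "\<lbrakk>g \<in> carrier G; A \<subseteq> \<Omega>\<rbrakk> \<Longrightarrow> y \<in> \<phi> (inv g) ` A \<longleftrightarrow> y \<in> \<Omega> \<and> \<phi> g y \<in> A"
  using mem_act_image[of "inv g" A y] by simp

lemma orb_iff: "y \<in> orb x \<longleftrightarrow> (\<exists>g\<in>carrier G. y = \<phi> g x)"
  unfolding orbit_def by blast

lemma orb_act [simp]: "g \<in> carrier G \<Longrightarrow> \<phi> g x \<in> orb x"
  unfolding orbit_def by blast

lemma orbE:
  assumes "y \<in> orb x"
  obtains g where "g \<in> carrier G" "y = \<phi> g x"
  using assms unfolding orbit_def by blast

lemma orb_refl [simp, intro]: "x \<in> \<Omega> \<Longrightarrow> x \<in> orb x"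
  by (rule act.orbit_refl)

lemma orb_sub: "\<lbrakk>y \<in> orb x; x \<in> \<Omega>\<rbrakk> \<Longrightarrow> y \<in> \<Omega>"
  unfolding orb_iff by auto

lemma orb_eq: "\<lbrakk>y \<in> orb x; x \<in> \<Omega>\<rbrakk> \<Longrightarrow> orb y = orb x"
proof -
  assume y: "y \<in> orb x" and x: "x \<in> \<Omega>"
  have *: "orb y \<subseteq> orb x" if "y \<in> orb x" "x \<in> \<Omega>" for x y
  proof
    note yx = that
    fix z assume "z \<in> orb y"
    then obtain g where g: "g \<in> carrier G" "z = \<phi> g y" by (rule orbE)
    obtain h where h: "h \<in> carrier G" "y = \<phi> h x" using yx(1) by (rule orbE)
    note gh = g(1) h(1) g(2)[unfolded h(2)]
    then have "z = \<phi> (g \<otimes> h) x" using that by (simp add: act_mult)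
    then show "z \<in> orb x" using gh unfolding orb_iff by blast
  qed
  have "x \<in> orb y"
  proof -
    obtain g where "g \<in> carrier G" "y = \<phi> g x" using y unfolding orb_iff by blast
    then have "x = \<phi> (inv g) y" "inv g \<in> carrier G" using x by auto
    then show ?thesis unfolding orb_iff by blast
  qed
  then show ?thesis using *[of y x] *[of x y] y x orb_sub by blast
qed

lemma act_measurable:
  assumes g: "g \<in> carrier G" and A: "A \<in> sets X"
  shows "\<phi> g ` A \<in> sets X"
proof -
  have A': "A \<subseteq> \<Omega>" using A by (rule sets.sets_into_space)
  have "(\<lambda>x. (inv g, x)) \<in> measurable X (count_space (carrier G) \<Otimes>\<^sub>M X)"
    using g by (intro measurable_Pair) auto
  moreover have "(\<lambda>(g, x). \<phi> g x) \<in> measurable (count_space (carrier G) \<Otimes>\<^sub>M X) X"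
    using space by (simp add: borel_G_space_def)
  ultimately have "(\<lambda>(g, x). \<phi> g x) \<circ> (\<lambda>x. (inv g, x)) \<in> measurable X X"
    by (rule measurable_comp)
  then have "\<phi> (inv g) \<in> measurable X X" by (simp add: comp_def)
  then have "\<phi> (inv g) -` A \<inter> \<Omega> \<in> sets X" using A by (rule measurable_sets)
  moreover have "\<phi> (inv g) -` A \<inter> \<Omega> = \<phi> g ` A"
    using mem_act_image[OF g A'] by blast
  ultimately show ?thesis by simp
qed

text \<open>Constructions are carried out inside an arbitrary \<open>L\<close> of this kind rather
  than in \<open>sets X\<close>, so that membership in \<open>L\<close> records which few Borel sets
  a construction depends on.\<close>

definition invariant_algebra :: "'a set set \<Rightarrow> bool" where
  "invariant_algebra L \<longleftrightarrow> sigma_algebra \<Omega> L \<and> (\<forall>g\<in>carrier G. \<forall>A\<in>L. \<phi> g ` A \<in> L)"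

text \<open>The same family of translates occurs in \<open>generator\<close>: a partition is a
  generator exactly when its \<open>gen_algebra\<close> is all of \<open>sets X\<close>.\<close>

definition gen_algebra :: "'a set set \<Rightarrow> 'a set set" where
  "gen_algebra S = sigma_sets \<Omega> {\<phi> g ` A | g A. g \<in> carrier G \<and> A \<in> S}"

lemma invariant_algebra_sets: "invariant_algebra (sets X)"
  unfolding invariant_algebra_def using act_measurable sets.sigma_algebra_axioms by blast

lemma ia_simps:
  assumes "invariant_algebra L"
  shows ia_sub: "A \<in> L \<Longrightarrow> A \<subseteq> \<Omega>"
    and ia_Un: "A \<in> L \<Longrightarrow> B \<in> L \<Longrightarrow> A \<union> B \<in> L"
    and ia_Int: "A \<in> L \<Longrightarrow> B \<in> L \<Longrightarrow> A \<inter> B \<in> L"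
    and ia_Diff: "A \<in> L \<Longrightarrow> B \<in> L \<Longrightarrow> A - B \<in> L"
    and ia_empty: "{} \<in> L" and ia_space: "\<Omega> \<in> L"
    and ia_UN: "countable I \<Longrightarrow> (\<And>i. i \<in> I \<Longrightarrow> f i \<in> L) \<Longrightarrow> (\<Union>i\<in>I. f i) \<in> L"
    and ia_INT: "countable I \<Longrightarrow> I \<noteq> {} \<Longrightarrow> (\<And>i. i \<in> I \<Longrightarrow> f i \<in> L) \<Longrightarrow> (\<Inter>i\<in>I. f i) \<in> L"
    and ia_act: "g \<in> carrier G \<Longrightarrow> A \<in> L \<Longrightarrow> \<phi> g ` A \<in> L"
proof -
  interpret sigma_algebra \<Omega> L using assms unfolding invariant_algebra_def by blast
  show "A \<in> L \<Longrightarrow> A \<subseteq> \<Omega>" using sets_into_space by blast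
  show "A \<in> L \<Longrightarrow> B \<in> L \<Longrightarrow> A \<union> B \<in> L" by blast
  show "A \<in> L \<Longrightarrow> B \<in> L \<Longrightarrow> A \<inter> B \<in> L" by blast
  show "A \<in> L \<Longrightarrow> B \<in> L \<Longrightarrow> A - B \<in> L" by blast
  show "{} \<in> L" "\<Omega> \<in> L" by auto
  show "countable I \<Longrightarrow> (\<And>i. i \<in> I \<Longrightarrow> f i \<in> L) \<Longrightarrow> (\<Union>i\<in>I. f i) \<in> L"
    by (rule countable_UN') auto
  show "countable I \<Longrightarrow> I \<noteq> {} \<Longrightarrow> (\<And>i. i \<in> I \<Longrightarrow> f i \<in> L) \<Longrightarrow> (\<Inter>i\<in>I. f i) \<in> L"
    by (rule countable_INT') auto
  show "g \<in> carrier G \<Longrightarrow> A \<in> L \<Longrightarrow> \<phi> g ` A \<in> L"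
    using assms unfolding invariant_algebra_def by blast
qed

lemma gen_basic: "A \<in> S \<Longrightarrow> A \<subseteq> \<Omega> \<Longrightarrow> A \<in> gen_algebra S"
proof -
  assume A: "A \<in> S" "A \<subseteq> \<Omega>"
  have "\<phi> \<one> ` A = A" using A(2) by (simp add: subset_iff cong: image_cong_simp)
  then have "\<exists>g B. A = \<phi> g ` B \<and> g \<in> carrier G \<and> B \<in> S" using A(1) one_closed by metis
  then have "A \<in> {\<phi> g ` A | g A. g \<in> carrier G \<and> A \<in> S}" by simp
  then show ?thesis unfolding gen_algebra_def by (rule sigma_sets.Basic)
qed

lemma gen_least:
  assumes L: "invariant_algebra L" and S: "S \<subseteq> L"
  shows "gen_algebra S \<subseteq> L"
proof -
  interpret sigma_algebra \<Omega> L using L unfolding invariant_algebra_def by blast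
  show ?thesis unfolding gen_algebra_def
    by (rule sigma_sets_subset) (use ia_act[OF L] S in auto)
qed

lemma gen_invariant_algebra:
  assumes S: "S \<subseteq> Pow \<Omega>"
  shows "invariant_algebra (gen_algebra S)"
proof -
  let ?B = "{\<phi> g ` A | g A. g \<in> carrier G \<and> A \<in> S}"
  have sub: "?B \<subseteq> Pow \<Omega>" using S act_in by fastforce
  have alg: "sigma_algebra \<Omega> (gen_algebra S)"
    unfolding gen_algebra_def by (rule sigma_algebra_sigma_sets[OF sub])
  then interpret sigma_algebra \<Omega> "gen_algebra S" .
  have "\<phi> g ` A \<in> gen_algebra S" if g: "g \<in> carrier G" and A: "A \<in> sigma_sets \<Omega> ?B" for g A
    using A
  proof (induction rule: sigma_sets.induct)
    case (Basic a)
    then obtain h B where h: "h \<in> carrier G" "B \<in> S" "a = \<phi> h ` B" by auto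
    have "\<phi> g ` a = \<phi> (g \<otimes> h) ` B"
      unfolding h(3) image_image 
    proof (rule image_cong)
      fix x assume "x \<in> B"
      then have "x \<in> \<Omega>" using S h(2) by blast
      then show "\<phi> g (\<phi> h x) = \<phi> (g \<otimes> h) x" using act_mult[OF g h(1)] by simp
    qed simp
    moreover have "\<phi> (g \<otimes> h) ` B \<in> ?B" using m_closed[OF g h(1)] h(2) by (intro CollectI exI conjI) auto
    ultimately have "\<phi> g ` a \<in> ?B" by (simp only:)
    then show ?case unfolding gen_algebra_def by (rule sigma_sets.Basic)
  next
    case Empty then show ?case by simp
  next
    case (Compl a)
    have a: "a \<subseteq> \<Omega>" using sigma_sets_into_sp[OF sub Compl.hyps] .
    have "\<phi> g ` (\<Omega> - a) = \<Omega> - \<phi> g ` a"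
      using inj_on_image_set_diff[OF act.inj_prop[OF g], of \<Omega> a] act.surj_prop[OF g] a by auto
    then show ?case using Compl.IH by auto
  next
    case (Union a)
    then show ?case unfolding image_UN by (intro countable_UN) auto
  qed
  then have "\<forall>g\<in>carrier G. \<forall>A\<in>gen_algebra S. \<phi> g ` A \<in> gen_algebra S"
    by (simp add: gen_algebra_def)
  with alg show ?thesis by (simp add: invariant_algebra_def)
qed

lemma gen_sets:
  assumes S: "S \<subseteq> sets X"
  shows "gen_algebra S \<subseteq> sets X"
  using gen_least[OF invariant_algebra_sets S] .

definition sat :: "'a set \<Rightarrow> 'a set" where
  "sat A = {x \<in> \<Omega>. orb x \<inter> A \<noteq> {}}"

lemma sat_in:
  assumes L: "invariant_algebra L" and A: "A \<in> L"
  shows "sat A \<in> L"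
proof -
  have "sat A = (\<Union>g\<in>carrier G. \<phi> (inv g) ` A)"
  proof (rule Set.set_eqI)
    fix x
    have "(orb x \<inter> A \<noteq> {}) \<longleftrightarrow> (\<exists>g\<in>carrier G. \<phi> g x \<in> A)"
      unfolding orbit_def by blast
    then show "x \<in> sat A \<longleftrightarrow> x \<in> (\<Union>g\<in>carrier G. \<phi> (inv g) ` A)"
      by (simp add: sat_def mem_act_image_inv[OF _ ia_sub[OF L A]])
  qed
  also have "\<dots> \<in> L"
    by (rule ia_UN[OF L cnt], rule ia_act[OF L _ A], rule inv_closed)
  finally show ?thesis .
qed

lemma sat_orb: "y \<in> orb x \<Longrightarrow> x \<in> \<Omega> \<Longrightarrow> y \<in> sat A \<longleftrightarrow> x \<in> sat A"
  using orb_eq[of y x] orb_sub[of y x] by (simp add: sat_def)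

definition invariant :: "'a set \<Rightarrow> bool" where
  "invariant Z \<longleftrightarrow> Z \<subseteq> \<Omega> \<and> (\<forall>x\<in>Z. orb x \<subseteq> Z)"

lemma invariantI: "(\<And>x. x \<in> Z \<Longrightarrow> x \<in> \<Omega>) \<Longrightarrow> (\<And>x y. x \<in> Z \<Longrightarrow> y \<in> orb x \<Longrightarrow> y \<in> Z) \<Longrightarrow> invariant Z"
  unfolding invariant_def by blast

lemma invariantD: "invariant Z \<Longrightarrow> y \<in> orb x \<Longrightarrow> x \<in> \<Omega> \<Longrightarrow> y \<in> Z \<longleftrightarrow> x \<in> Z"
  unfolding invariant_def by (metis orb_eq orb_refl subsetD)

lemma invariant_act: "invariant Z \<Longrightarrow> g \<in> carrier G \<Longrightarrow> x \<in> \<Omega> \<Longrightarrow> \<phi> g x \<in> Z \<longleftrightarrow> x \<in> Z"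
  using invariantD[of Z "\<phi> g x" x] by simp

section \<open>Definable partial injections and coding\<close>

text \<open>A union of graphs of group elements over domains in \<open>L\<close>. The domains may
  overlap and the relation may be many-valued, so unions, converses and compositions need no choice
  of group elements; uniqueness is imposed afterwards by \<open>pinj\<close>.\<close>

definition drel :: "'a set set \<Rightarrow> ('a \<times> 'a) set \<Rightarrow> bool" where
  "drel L R \<longleftrightarrow> (\<exists>M. (\<forall>g\<in>carrier G. M g \<in> L)
     \<and> (\<forall>x y. (x, y) \<in> R \<longleftrightarrow> (\<exists>g\<in>carrier G. x \<in> M g \<and> y = \<phi> g x)))"

lemma drelI:
  assumes "\<And>g. g \<in> carrier G \<Longrightarrow> M g \<in> L"
    and "\<And>x y. (x, y) \<in> R \<longleftrightarrow> (\<exists>g\<in>carrier G. x \<in> M g \<and> y = \<phi> g x)"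
  shows "drel L R"
  unfolding drel_def using assms by (intro exI[of _ M] conjI ballI allI)

lemma drelE:
  assumes "drel L R"
  obtains M where "\<And>g. g \<in> carrier G \<Longrightarrow> M g \<in> L"
    "\<And>x y. (x, y) \<in> R \<longleftrightarrow> (\<exists>g\<in>carrier G. x \<in> M g \<and> y = \<phi> g x)"
proof -
  obtain M where M: "\<forall>g\<in>carrier G. M g \<in> L"
    "\<forall>x y. (x, y) \<in> R \<longleftrightarrow> (\<exists>g\<in>carrier G. x \<in> M g \<and> y = \<phi> g x)"
    using assms unfolding drel_def by (elim exE conjE)
  show thesis by (rule that[of M]) (use M in simp_all)
qed

lemma drel_mem:
  assumes L: "invariant_algebra L" and R: "drel L R" and xy: "(x, y) \<in> R"
  shows drel_dom: "x \<in> \<Omega>" and drel_ran: "y \<in> \<Omega>" and drel_orb: "y \<in> orb x" and drel_orb': "orb y = orb x"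
proof -
  obtain M where M: "\<And>g. g \<in> carrier G \<Longrightarrow> M g \<in> L"
    "\<And>x y. (x, y) \<in> R \<longleftrightarrow> (\<exists>g\<in>carrier G. x \<in> M g \<and> y = \<phi> g x)"
    by (rule drelE[OF R], rule that)
  obtain g where g: "g \<in> carrier G" "x \<in> M g" "y = \<phi> g x" using xy unfolding M(2) by auto
  show x: "x \<in> \<Omega>" using ia_sub[OF L M(1)[OF g(1)]] g(2) by (rule subsetD)
  show "y \<in> \<Omega>" "y \<in> orb x" using g x by simp_all
  then show "orb y = orb x" using orb_eq x by simp
qed

lemma drel_converse:
  assumes L: "invariant_algebra L" and R: "drel L R"
  shows "drel L (R\<inverse>)"
proof -
  obtain M where M: "\<And>g. g \<in> carrier G \<Longrightarrow> M g \<in> L"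
    "\<And>x y. (x, y) \<in> R \<longleftrightarrow> (\<exists>g\<in>carrier G. x \<in> M g \<and> y = \<phi> g x)"
    by (rule drelE[OF R], rule that)
  note sub = ia_sub[OF L M(1)]
  show ?thesis
  proof (rule drelI[of "\<lambda>g. \<phi> (inv g) ` M (inv g)"])
    show "\<phi> (inv g) ` M (inv g) \<in> L" if "g \<in> carrier G" for g
      using ia_act[OF L _ M(1)] that by simp
    fix x y
    have mem: "x \<in> \<phi> (inv g) ` M (inv g) \<longleftrightarrow> x \<in> \<Omega> \<and> \<phi> g x \<in> M (inv g)" if "g \<in> carrier G" for g
      using that sub by (intro mem_act_image_inv) auto
    show "(x, y) \<in> R\<inverse> \<longleftrightarrow> (\<exists>g\<in>carrier G. x \<in> \<phi> (inv g) ` M (inv g) \<and> y = \<phi> g x)"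
    proof
      assume "(x, y) \<in> R\<inverse>"
      then obtain g where g: "g \<in> carrier G" "y \<in> M g" "x = \<phi> g y" using M(2)[of y x] by auto
      have y: "y \<in> \<Omega>" using sub[OF g(1)] g(2) by (rule subsetD)
      show "\<exists>g\<in>carrier G. x \<in> \<phi> (inv g) ` M (inv g) \<and> y = \<phi> g x"
        by (rule bexI[of _ "inv g"]) (use mem[of "inv g"] g y in simp_all)
    next
      assume "\<exists>g\<in>carrier G. x \<in> \<phi> (inv g) ` M (inv g) \<and> y = \<phi> g x"
      then obtain g where g: "g \<in> carrier G" "x \<in> \<Omega>" "\<phi> g x \<in> M (inv g)" "y = \<phi> g x"
        using mem by (elim bexE conjE) simp
      then have "y \<in> M (inv g)" "x = \<phi> (inv g) y" "inv g \<in> carrier G" by simp_all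
      then show "(x, y) \<in> R\<inverse>" unfolding converse_iff M(2) by (intro bexI conjI)
    qed
  qed
qed

lemma drel_UN:
  assumes L: "invariant_algebra L" and I: "countable I" and R: "\<And>i. i \<in> I \<Longrightarrow> drel L (R i)"
  shows "drel L (\<Union>i\<in>I. R i)"
proof -
  have "\<exists>M. \<forall>i\<in>I. (\<forall>g\<in>carrier G. M i g \<in> L)
     \<and> (\<forall>x y. (x, y) \<in> R i \<longleftrightarrow> (\<exists>g\<in>carrier G. x \<in> M i g \<and> y = \<phi> g x))"
    using R unfolding drel_def by (intro bchoice ballI) simp
  then obtain M where M: "\<And>i g. i \<in> I \<Longrightarrow> g \<in> carrier G \<Longrightarrow> M i g \<in> L"
    "\<And>i x y. i \<in> I \<Longrightarrow> (x, y) \<in> R i \<longleftrightarrow> (\<exists>g\<in>carrier G. x \<in> M i g \<and> y = \<phi> g x)" by metis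
  show ?thesis
  proof (rule drelI[of "\<lambda>g. \<Union>i\<in>I. M i g"])
    show "(\<Union>i\<in>I. M i g) \<in> L" if "g \<in> carrier G" for g
      by (rule ia_UN[OF L I]) (rule M(1)[OF _ that])
  qed (auto simp: M(2))
qed

lemma drel_Un:
  assumes L: "invariant_algebra L" and R: "drel L R" "drel L R'"
  shows "drel L (R \<union> R')"
proof -
  have "drel L (\<Union>b\<in>{True, False}. if b then R else R')"
    by (rule drel_UN[OF L]) (use R in auto)
  then show ?thesis by (simp add: Un_commute)
qed

lemma drel_empty: "invariant_algebra L \<Longrightarrow> drel L {}"
  using drel_UN[of L "{}" id] by simp

lemma drel_restrict:
  assumes L: "invariant_algebra L" and R: "drel L R" and A: "A \<in> L" and B: "B \<in> L"
  shows "drel L (R \<inter> A \<times> B)"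
proof -
  obtain M where M: "\<And>g. g \<in> carrier G \<Longrightarrow> M g \<in> L"
    "\<And>x y. (x, y) \<in> R \<longleftrightarrow> (\<exists>g\<in>carrier G. x \<in> M g \<and> y = \<phi> g x)"
    by (rule drelE[OF R], rule that)
  note sub = ia_sub[OF L M(1)]
  show ?thesis
  proof (rule drelI[of "\<lambda>g. M g \<inter> A \<inter> \<phi> (inv g) ` B"])
    show "M g \<inter> A \<inter> \<phi> (inv g) ` B \<in> L" if "g \<in> carrier G" for g
      using ia_Int[OF L] ia_act[OF L _ B] M(1) A that by simp
    fix x y
    have "x \<in> M g \<inter> A \<inter> \<phi> (inv g) ` B \<longleftrightarrow> x \<in> M g \<and> x \<in> A \<and> \<phi> g x \<in> B" if "g \<in> carrier G" for g
      using that sub[OF that] by (auto simp: mem_act_image_inv[OF that ia_sub[OF L B]])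
    then show "(x, y) \<in> R \<inter> A \<times> B \<longleftrightarrow> (\<exists>g\<in>carrier G. x \<in> M g \<inter> A \<inter> \<phi> (inv g) ` B \<and> y = \<phi> g x)"
      by (simp add: M(2)) blast
  qed
qed

lemma drel_comp:
  assumes L: "invariant_algebra L" and R: "drel L R" "drel L R'"
  shows "drel L (R O R')"
proof -
  obtain M where M: "\<And>g. g \<in> carrier G \<Longrightarrow> M g \<in> L"
    "\<And>x y. (x, y) \<in> R \<longleftrightarrow> (\<exists>g\<in>carrier G. x \<in> M g \<and> y = \<phi> g x)"
    by (rule drelE[OF R(1)], rule that)
  obtain M' where M': "\<And>g. g \<in> carrier G \<Longrightarrow> M' g \<in> L"
    "\<And>x y. (x, y) \<in> R' \<longleftrightarrow> (\<exists>g\<in>carrier G. x \<in> M' g \<and> y = \<phi> g x)"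
    by (rule drelE[OF R(2)], rule that)
  note sub = ia_sub[OF L M(1)] note sub' = ia_sub[OF L M'(1)]
  \<comment> \<open>A composite moves \<open>x\<close> by some \<open>k\<close>; once the first
    factor \<open>g\<close> is fixed, the second one must be
    \<open>k \<otimes> inv g\<close>.\<close>
  let ?N = "\<lambda>k. \<Union>g\<in>carrier G. M g \<inter> \<phi> (inv g) ` M' (k \<otimes> inv g)"
  have mem: "x \<in> M g \<inter> \<phi> (inv g) ` M' h \<longleftrightarrow> x \<in> M g \<and> \<phi> g x \<in> M' h"
    if "g \<in> carrier G" "h \<in> carrier G" for g h x
    using that sub[OF that(1)] by (auto simp: mem_act_image_inv[OF that(1) sub'[OF that(2)]])
  show ?thesis
  proof (rule drelI[of ?N])
    show "?N k \<in> L" if k: "k \<in> carrier G" for k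
    proof (rule ia_UN[OF L cnt])
      fix g assume "g \<in> carrier G"
      then show "M g \<inter> \<phi> (inv g) ` M' (k \<otimes> inv g) \<in> L"
        using ia_Int[OF L] ia_act[OF L] M(1) M'(1) k by simp
    qed
    fix x z
    have "(x, z) \<in> R O R' \<longleftrightarrow> (\<exists>g\<in>carrier G. \<exists>h\<in>carrier G. x \<in> M g \<and> \<phi> g x \<in> M' h \<and> z = \<phi> h (\<phi> g x))"
      unfolding relcomp_unfold mem_Collect_eq case_prod_conv M(2) M'(2) by blast
    also have "\<dots> \<longleftrightarrow> (\<exists>k\<in>carrier G. x \<in> ?N k \<and> z = \<phi> k x)"
    proof
      assume "\<exists>g\<in>carrier G. \<exists>h\<in>carrier G. x \<in> M g \<and> \<phi> g x \<in> M' h \<and> z = \<phi> h (\<phi> g x)"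
      then obtain g h where gh: "g \<in> carrier G" "h \<in> carrier G" "x \<in> M g" "\<phi> g x \<in> M' h" "z = \<phi> h (\<phi> g x)"
        by (elim bexE conjE)
      have x: "x \<in> \<Omega>" using sub[OF gh(1)] gh(3) by (rule subsetD)
      have h: "h \<otimes> g \<otimes> inv g = h" using gh by (simp add: m_assoc)
      have "x \<in> M g \<inter> \<phi> (inv g) ` M' (h \<otimes> g \<otimes> inv g)" unfolding h by (rule mem[OF gh(1,2), THEN iffD2], rule conjI[OF gh(3,4)])
      then have "x \<in> ?N (h \<otimes> g)" using gh(1) by (rule UN_I[rotated])
      moreover have "z = \<phi> (h \<otimes> g) x" using gh x by (simp add: act_mult)
      ultimately show "\<exists>k\<in>carrier G. x \<in> ?N k \<and> z = \<phi> k x" using gh(1,2) by (intro bexI[of _ "h \<otimes> g"] conjI m_closed)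
    next
      assume "\<exists>k\<in>carrier G. x \<in> ?N k \<and> z = \<phi> k x"
      then obtain k g where k: "k \<in> carrier G" "z = \<phi> k x" and g: "g \<in> carrier G"
        "x \<in> M g \<inter> \<phi> (inv g) ` M' (k \<otimes> inv g)" by (elim bexE conjE UN_E)
      define h where "h = k \<otimes> inv g"
      have h: "h \<in> carrier G" unfolding h_def using k g by simp
      have *: "x \<in> M g" "\<phi> g x \<in> M' h" using mem[OF g(1) h] g(2) unfolding h_def[symmetric] by simp_all
      have x: "x \<in> \<Omega>" using sub[OF g(1)] *(1) by (rule subsetD)
      have "h \<otimes> g = k" unfolding h_def using k g by (simp add: m_assoc)
      then have "z = \<phi> h (\<phi> g x)" using act_mult[OF h g(1) x] k(2) by simp
      then show "\<exists>g\<in>carrier G. \<exists>h\<in>carrier G. x \<in> M g \<and> \<phi> g x \<in> M' h \<and> z = \<phi> h (\<phi> g x)"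
        using g(1) h * by (intro bexI conjI)
    qed
    finally show "(x, z) \<in> R O R' \<longleftrightarrow> (\<exists>k\<in>carrier G. x \<in> ?N k \<and> z = \<phi> k x)" .
  qed
qed

lemma drel_Domain:
  assumes L: "invariant_algebra L" and R: "drel L R"
  shows "Domain R \<in> L"
proof -
  obtain M where M: "\<And>g. g \<in> carrier G \<Longrightarrow> M g \<in> L"
    "\<And>x y. (x, y) \<in> R \<longleftrightarrow> (\<exists>g\<in>carrier G. x \<in> M g \<and> y = \<phi> g x)"
    by (rule drelE[OF R], rule that)
  have "Domain R = (\<Union>g\<in>carrier G. M g)" unfolding Domain_iff M(2) Bex_def set_eq_iff UN_iff by metis
  then show ?thesis using ia_UN[OF L cnt M(1)] by simp
qed

lemma drel_Range:
  assumes L: "invariant_algebra L" and R: "drel L R"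
  shows "Range R \<in> L"
  using drel_Domain[OF L drel_converse[OF L R]] by simp

lemma drel_shift:
  assumes L: "invariant_algebra L" and A: "A \<in> L" and h: "h \<in> carrier G"
  shows "drel L {(x, \<phi> h x) | x. x \<in> A}"
  by (rule drelI[of "\<lambda>g. if g = h then A else {}"]) (use A h ia_empty[OF L] in auto)

text \<open>These are the elements of the full pseudogroup of the orbit equivalence relation whose
  pieces lie in \<open>L\<close>.\<close>

definition pinj :: "'a set set \<Rightarrow> ('a \<times> 'a) set \<Rightarrow> bool" where
  "pinj L R \<longleftrightarrow> drel L R \<and> single_valued R \<and> single_valued (R\<inverse>)"

lemma pinjI:
  assumes "drel L R" "\<And>x y z. (x, y) \<in> R \<Longrightarrow> (x, z) \<in> R \<Longrightarrow> y = z"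
    "\<And>x y z. (x, z) \<in> R \<Longrightarrow> (y, z) \<in> R \<Longrightarrow> x = y"
  shows "pinj L R"
  unfolding pinj_def single_valued_def using assms by blast

lemma pinj_drel: "pinj L R \<Longrightarrow> drel L R"
  and pinj_fun: "pinj L R \<Longrightarrow> (x, y) \<in> R \<Longrightarrow> (x, z) \<in> R \<Longrightarrow> y = z"
  and pinj_inj: "pinj L R \<Longrightarrow> (x, z) \<in> R \<Longrightarrow> (y, z) \<in> R \<Longrightarrow> x = y"
  unfolding pinj_def single_valued_def by blast+

lemma pinj_restrict:
  "\<lbrakk>invariant_algebra L; pinj L R; A \<in> L; B \<in> L\<rbrakk> \<Longrightarrow> pinj L (R \<inter> A \<times> B)"
  by (rule pinjI) (auto intro: drel_restrict dest: pinj_drel pinj_fun pinj_inj)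

lemma pinj_comp:
  "\<lbrakk>invariant_algebra L; pinj L R; pinj L R'\<rbrakk> \<Longrightarrow> pinj L (R O R')"
  by (rule pinjI) (auto intro: drel_comp dest: pinj_drel pinj_fun pinj_inj)

lemma pinj_shift:
  assumes "invariant_algebra L" "A \<in> L" "h \<in> carrier G"
  shows "pinj L {(x, \<phi> h x) | x. x \<in> A}"
proof (rule pinjI)
  show "x = y" if "(x, z) \<in> {(x, \<phi> h x) | x. x \<in> A}" "(y, z) \<in> {(x, \<phi> h x) | x. x \<in> A}" for x y z
    using that act.inj_prop[OF assms(3)] ia_sub[OF assms(1,2)] by (auto dest: inj_onD)
qed (use drel_shift assms in auto)

text \<open>\<open>R ^^ 0\<close> is the identity of the whole type and may leave
  \<open>\<Omega>\<close>; composing with the identity of \<open>\<Omega>\<close> repairs this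
  case.\<close>

lemma pinj_relpow:
  assumes L: "invariant_algebra L" and R: "pinj L R"
  shows "pinj L (Restr Id \<Omega> O R ^^ n)"
proof (induction n)
  case 0
  have "Restr Id \<Omega> = {(x, \<phi> \<one> x) | x. x \<in> \<Omega>}" by auto
  then show ?case using pinj_shift[OF L ia_space[OF L] one_closed] by (simp only: relpow.simps R_O_Id)
next
  case (Suc n)
  then show ?case using pinj_comp[OF L Suc R] by (simp add: O_assoc)
qed

text \<open>A system \<^term>\<open>M\<close> describes partial maps \<open>T\<^sub>n\<close>, sending \<open>x \<in> M n g\<close> to \<open>g x\<close>. The bad set is where these
  fail to be well-defined injections with pairwise disjoint ranges; \<open>code_dom\<close> consists of the good
  orbits which contain a point lying in the domain of every \<open>T\<^sub>n\<close>.\<close>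

definition bad :: "(nat \<Rightarrow> 'g \<Rightarrow> 'a set) \<Rightarrow> 'a set" where
  "bad M = (\<Union>(n, g, h) \<in> {(n, g, h). g \<in> carrier G \<and> h \<in> carrier G \<and> g \<noteq> h}. M n g \<inter> M n h)
     \<union> (\<Union>(n, g, m, h) \<in> {(n, g, m, h). g \<in> carrier G \<and> h \<in> carrier G \<and> (n, g) \<noteq> (m, h)}.
          \<phi> g ` M n g \<inter> \<phi> h ` M m h)"

definition core :: "(nat \<Rightarrow> 'g \<Rightarrow> 'a set) \<Rightarrow> 'a set" where
  "core M = (\<Inter>n. \<Union>g\<in>carrier G. M n g)"

definition code_dom :: "(nat \<Rightarrow> 'g \<Rightarrow> 'a set) \<Rightarrow> 'a set" where
  "code_dom M = sat (core M) - sat (bad M)"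

text \<open>Only the system has to lie in \<open>L\<close>, and it has to work only on the orbits
  meeting \<open>Z\<close>. Hence \<open>Z\<close> may be an arbitrary exceptional set, and the
  system may be altered on other orbits when pieces are glued.\<close>

definition codable :: "'a set set \<Rightarrow> 'a set \<Rightarrow> bool" where
  "codable L Z \<longleftrightarrow> (\<exists>M. (\<forall>n. \<forall>g\<in>carrier G. M n g \<in> L) \<and> Z \<subseteq> code_dom M)"

lemma code_dom_in:
  assumes L: "invariant_algebra L" and M: "\<And>n g. g \<in> carrier G \<Longrightarrow> M n g \<in> L"
  shows "core M \<in> L" "bad M \<in> L" "code_dom M \<in> L"
proof -
  show core: "core M \<in> L"
    unfolding core_def by (intro ia_INT[OF L] ia_UN[OF L cnt] M) auto
  have 1: "countable {(n::nat, g, h). g \<in> carrier G \<and> h \<in> carrier G \<and> g \<noteq> h}"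
    by (rule countable_subset[of _ "UNIV \<times> carrier G \<times> carrier G"]) (use cnt in auto)
  have 2: "countable {(n::nat, g, m::nat, h). g \<in> carrier G \<and> h \<in> carrier G \<and> (n, g) \<noteq> (m, h)}"
    by (rule countable_subset[of _ "UNIV \<times> carrier G \<times> UNIV \<times> carrier G"]) (use cnt in auto)
  show bad: "bad M \<in> L"
    unfolding bad_def
    by (intro ia_Un[OF L] ia_UN[OF L 1] ia_UN[OF L 2])
       (auto intro!: ia_Int[OF L] ia_act[OF L] M)
  show "code_dom M \<in> L" unfolding code_dom_def by (intro ia_Diff[OF L] sat_in[OF L] core bad)
qed

lemma codableI:
  fixes T :: "nat \<Rightarrow> ('a \<times> 'a) set"
  assumes L: "invariant_algebra L" and T: "\<And>n. pinj L (T n)"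
    and disj: "\<And>n m. n \<noteq> m \<Longrightarrow> Range (T n) \<inter> Range (T m) = {}"
    and Z: "\<And>x. x \<in> Z \<Longrightarrow> x \<in> \<Omega> \<and> (\<exists>y\<in>orb x. \<forall>n. y \<in> Domain (T n))"
  shows "codable L Z"
proof -
  have "\<exists>M. \<forall>n. (\<forall>g\<in>carrier G. M n g \<in> L)
     \<and> (\<forall>x y. (x, y) \<in> T n \<longleftrightarrow> (\<exists>g\<in>carrier G. x \<in> M n g \<and> y = \<phi> g x))"
    using pinj_drel[OF T] unfolding drel_def by (intro choice allI)
  then obtain M where M: "\<And>n g. g \<in> carrier G \<Longrightarrow> M n g \<in> L"
    "\<And>n x y. (x, y) \<in> T n \<longleftrightarrow> (\<exists>g\<in>carrier G. x \<in> M n g \<and> y = \<phi> g x)" by metis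
  define idx where "idx = to_nat_on (carrier G)"
  have idx: "inj_on idx (carrier G)" unfolding idx_def using cnt by (rule inj_on_to_nat_on)
  \<comment> \<open>Points with nontrivial stabilizers can be sent to the same place by several
    group elements, which \<open>bad\<close> forbids. Keeping only the element of least index
    removes the ambiguity.\<close>
  define N where "N n g = M n g - (\<Union>h\<in>{h\<in>carrier G. idx h < idx g}. M n h)" for n :: nat and g
  have NL: "N n g \<in> L" if "g \<in> carrier G" for n g
    unfolding N_def by (intro ia_Diff[OF L] ia_UN[OF L] M(1)) (use cnt that in auto)
  have NT: "(x, \<phi> g x) \<in> T n" if "g \<in> carrier G" "x \<in> N n g" for x n g
    using that unfolding M(2) N_def by (intro bexI[of _ g]) auto
  have Nsub: "x \<in> \<Omega>" if "g \<in> carrier G" "x \<in> N n g" for x n g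
    using ia_sub[OF L NL[OF that(1)]] that(2) by (rule subsetD)
  have Ndisj: "g = h" if "g \<in> carrier G" "h \<in> carrier G" "x \<in> N n g" "x \<in> N n h" for x n g h
  proof (rule ccontr)
    assume "g \<noteq> h"
    then have "idx g < idx h \<or> idx h < idx g" using idx that by (metis inj_onD linorder_neq_iff)
    then show False using that unfolding N_def by auto
  qed
  have "bad N = {}"
  proof -
    have F: False if g: "g \<in> carrier G" "h \<in> carrier G" "(n, g) \<noteq> (m, h)" "x \<in> N n g" "y \<in> N m h" "\<phi> g x = \<phi> h y"
      for n m g h x y
    proof -
      have 1: "(x, \<phi> g x) \<in> T n" "(y, \<phi> g x) \<in> T m"
        using NT[OF g(1,4)] NT[OF g(2,5)] g(6) by simp_all
      then have nm: "n = m" using disj[of n m] by blast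
      have "x = y" using pinj_inj[OF T 1(1) 1(2)[folded nm]] .
      then show False using Ndisj[of g h x n] g nm by auto
    qed
    then show ?thesis unfolding bad_def by (auto dest: Ndisj) (metis F Pair_inject)+
  qed
  moreover have "Z \<subseteq> sat (core N)"
  proof
    fix x assume "x \<in> Z"
    then obtain y where x: "x \<in> \<Omega>" and y: "y \<in> orb x" "\<And>n. y \<in> Domain (T n)" using Z by metis
    have "\<exists>g\<in>carrier G. y \<in> N n g" for n
    proof -
      let ?P = "\<lambda>g. g \<in> carrier G \<and> y \<in> M n g"
      have "\<exists>g. ?P g" using y(2)[of n] unfolding Domain_iff M(2) by metis
      then obtain k where "?P k" by (rule exE)
      then have min: "?P (arg_min idx ?P)" "\<forall>h. ?P h \<longrightarrow> idx (arg_min idx ?P) \<le> idx h"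
        using arg_min_nat_lemma[of ?P k idx] by simp_all
      then show ?thesis unfolding N_def by (intro bexI[of _ "arg_min idx ?P"]) (auto simp: not_less)
    qed
    then have "y \<in> core N" unfolding core_def by auto
    then show "x \<in> sat (core N)" using x y(1) unfolding sat_def by auto
  qed
  ultimately have "Z \<subseteq> code_dom N" by (auto simp: code_dom_def sat_def)
  then show ?thesis unfolding codable_def using NL by (intro exI[of _ N] conjI allI ballI)
qed

section \<open>Packing and covering by copies of a set\<close>

definition enum :: "nat \<Rightarrow> 'g" where
  "enum = from_nat_into (carrier G)"

lemma enum_in [simp]: "enum n \<in> carrier G"
  unfolding enum_def using from_nat_into[of "carrier G"] one_closed by blast

lemma enum_surj: "g \<in> carrier G \<Longrightarrow> \<exists>n. enum n = g"
  unfolding enum_def using from_nat_into_surj[OF cnt] by blast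

text \<open>Stage \<open>n\<close> uses the single element \<open>enum n\<close>, which acts
  injectively, so all its new pairs can be added at once without collisions.\<close>

primrec greedy_upto :: "'a set \<Rightarrow> 'a set \<Rightarrow> nat \<Rightarrow> ('a \<times> 'a) set" where
  "greedy_upto F B 0 = {}"
| "greedy_upto F B (Suc n) = greedy_upto F B n \<union>
     {(x, \<phi> (enum n) x) | x. x \<in> \<Omega>} \<inter> (F - Domain (greedy_upto F B n)) \<times> (B - Range (greedy_upto F B n))"

definition greedy :: "'a set \<Rightarrow> 'a set \<Rightarrow> ('a \<times> 'a) set" where
  "greedy F B = (\<Union>n. greedy_upto F B n)"

lemma greedy_upto_pinj:
  assumes L: "invariant_algebra L" and F: "F \<in> L" and B: "B \<in> L"
  shows "pinj L (greedy_upto F B n)"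
proof (induction n)
  case 0
  show ?case by (rule pinjI) (use drel_empty[OF L] in auto)
next
  case (Suc n)
  let ?R = "greedy_upto F B n"
  let ?S = "{(x, \<phi> (enum n) x) | x. x \<in> \<Omega>} \<inter> (F - Domain ?R) \<times> (B - Range ?R)"
  note d = pinj_drel[OF Suc]
  have S: "pinj L ?S"
    by (intro pinj_restrict[OF L] pinj_shift[OF L] ia_space[OF L] enum_in ia_Diff[OF L]
        drel_Domain[OF L] drel_Range[OF L] d F B)
  show ?case unfolding greedy_upto.simps
  proof (rule pinjI)
    show "drel L (?R \<union> ?S)" by (intro drel_Un[OF L] d pinj_drel[OF S])
    show "y = z" if "(x, y) \<in> ?R \<union> ?S" "(x, z) \<in> ?R \<union> ?S" for x y z
      using that pinj_fun[OF Suc] pinj_fun[OF S] by blast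
    show "x = y" if "(x, z) \<in> ?R \<union> ?S" "(y, z) \<in> ?R \<union> ?S" for x y z
      using that pinj_inj[OF Suc] pinj_inj[OF S] by blast
  qed
qed

lemma greedy_upto_mono: "m \<le> n \<Longrightarrow> greedy_upto F B m \<subseteq> greedy_upto F B n"
  by (rule lift_Suc_mono_le[of "greedy_upto F B"]) auto

lemma greedy_pinj:
  assumes L: "invariant_algebra L" and F: "F \<in> L" and B: "B \<in> L"
  shows "pinj L (greedy F B)"
proof (rule pinjI)
  note p = greedy_upto_pinj[OF assms]
  show "drel L (greedy F B)" unfolding greedy_def
    by (rule drel_UN[OF L]) (use pinj_drel[OF p] in auto)
  have common: "\<exists>n. p \<in> greedy_upto F B n \<and> q \<in> greedy_upto F B n" if pq: "p \<in> greedy F B" "q \<in> greedy F B" for p q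
  proof -
    obtain n m where "p \<in> greedy_upto F B n" "q \<in> greedy_upto F B m"
      using pq unfolding greedy_def UN_iff by metis
    then show ?thesis using greedy_upto_mono[of n "max n m" F B] greedy_upto_mono[of m "max n m" F B]
      by (intro exI[of _ "max n m"]) auto
  qed
  show "y = z" if "(x, y) \<in> greedy F B" "(x, z) \<in> greedy F B" for x y z
    using common[OF that] pinj_fun[OF p] by metis
  show "x = y" if "(x, z) \<in> greedy F B" "(y, z) \<in> greedy F B" for x y z
    using common[OF that] pinj_inj[OF p] by metis
qed

lemma greedy_sub: "greedy F B \<subseteq> F \<times> B"
proof -
  have "greedy_upto F B n \<subseteq> F \<times> B" for n by (induction n) auto
  then show ?thesis unfolding greedy_def by blast
qed

text \<open>Otherwise the stage of a group element taking \<open>x\<close> to \<open>y\<close> would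
  have matched the two. Thus on each orbit either all of \<open>F\<close> is matched or all of
  \<open>B\<close> is used.\<close>

lemma greedy_maximal:
  assumes "x \<in> F" "x \<in> \<Omega>" "x \<notin> Domain (greedy F B)" "y \<in> orb x" "y \<in> B"
  shows "y \<in> Range (greedy F B)"
proof (rule ccontr)
  assume y: "y \<notin> Range (greedy F B)"
  obtain g where g: "g \<in> carrier G" "y = \<phi> g x" using assms(4) by (rule orbE)
  obtain n where n: "enum n = g" using enum_surj[OF g(1)] by blast
  have sub: "greedy_upto F B k \<subseteq> greedy F B" for k unfolding greedy_def by blast
  have "(x, y) \<in> greedy_upto F B (Suc n)"
    using assms y n g(2) sub[of n] by auto
  then show False using sub assms(3) by (meson DomainI subsetD)
qed

section \<open>Successive disjoint copies of a set, and the orbits on which they fit\<close>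

primrec used :: "'a set \<Rightarrow> 'a set \<Rightarrow> nat \<Rightarrow> 'a set" where
  "used Y F 0 = {}"
| "used Y F (Suc i) = used Y F i \<union> Range (greedy F (Y - used Y F i))"

definition tile :: "'a set \<Rightarrow> 'a set \<Rightarrow> nat \<Rightarrow> ('a \<times> 'a) set" where
  "tile Y F i = greedy F (Y - used Y F i)"

text \<open>Refers to the fixed greedy tiles, not to the existence of some packing. A different
  packing could give a different count, but \<open>codable_packs_covers\<close> shows that a real
  discrepancy forces a compression.\<close>

definition packed :: "'a set \<Rightarrow> 'a set \<Rightarrow> nat \<Rightarrow> 'a set" where
  "packed Y F m = {x \<in> \<Omega>. \<forall>i<m. F \<inter> orb x \<subseteq> Domain (tile Y F i)}"

lemma used_eq: "used Y F n = (\<Union>i<n. Range (tile Y F i))"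
  by (induction n) (auto simp: tile_def lessThan_Suc)

lemma tile_pinj:
  assumes L: "invariant_algebra L" and F: "F \<in> L" and Y: "Y \<in> L"
  shows "pinj L (tile Y F i)"
proof -
  have "used Y F n \<in> L" for n
    by (induction n)
       (auto intro!: ia_empty[OF L] ia_Un[OF L] drel_Range[OF L] pinj_drel[OF greedy_pinj[OF L F]] ia_Diff[OF L Y])
  then show ?thesis unfolding tile_def by (intro greedy_pinj[OF L F] ia_Diff[OF L Y])
qed

lemma tile_sub: "tile Y F i \<subseteq> F \<times> Y"
  unfolding tile_def using greedy_sub by blast

lemma tile_disj:
  assumes "i \<noteq> j"
  shows "Range (tile Y F i) \<inter> Range (tile Y F j) = {}"
proof -
  have *: "Range (tile Y F i) \<inter> Range (tile Y F j) = {}" if "i < j" for i j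
  proof -
    have "Range (tile Y F i) \<subseteq> used Y F j" using that by (auto simp: used_eq)
    moreover have "Range (tile Y F j) \<subseteq> Y - used Y F j" unfolding tile_def using greedy_sub by blast
    ultimately show ?thesis by blast
  qed
  show ?thesis using *[of i j] *[of j i] assms by (cases "i < j") auto
qed

lemma packed_orb: "y \<in> orb x \<Longrightarrow> x \<in> \<Omega> \<Longrightarrow> y \<in> packed Y F m \<longleftrightarrow> x \<in> packed Y F m"
  using orb_eq[of y x] orb_sub[of y x] by (simp add: packed_def)

text \<open>With \<open>covers\<close> this forms a pair of certificates by arbitrary maps over a
  region \<open>Z\<close>. Greedy tiles provide one or the other, and unlike the tiles the
  certificates can be united, restricted, shifted and composed.\<close>

definition packs :: "'a set set \<Rightarrow> 'a set \<Rightarrow> 'a set \<Rightarrow> 'a set \<Rightarrow> nat \<Rightarrow> bool" where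
  "packs L F Y Z m \<longleftrightarrow> (\<exists>\<mu>. (\<forall>i<m. pinj L (\<mu> i) \<and> F \<inter> Z \<subseteq> Domain (\<mu> i) \<and> Range (\<mu> i) \<subseteq> Y)
     \<and> (\<forall>i<m. \<forall>j<m. i \<noteq> j \<longrightarrow> Range (\<mu> i) \<inter> Range (\<mu> j) = {}))"

definition covers :: "'a set set \<Rightarrow> 'a set \<Rightarrow> 'a set \<Rightarrow> 'a set \<Rightarrow> nat \<Rightarrow> bool" where
  "covers L F Y Z k \<longleftrightarrow> (\<exists>\<nu>. (\<forall>j<k. pinj L (\<nu> j) \<and> Domain (\<nu> j) \<subseteq> F)
     \<and> Y \<inter> Z \<subseteq> (\<Union>j<k. Range (\<nu> j)))"

lemma packs_packed:
  assumes L: "invariant_algebra L" and F: "F \<in> L" and Y: "Y \<in> L" and Z: "Z \<subseteq> packed Y F m"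
  shows "packs L F Y Z m"
  unfolding packs_def
proof (intro exI[of _ "tile Y F"] conjI allI impI)
  show "F \<inter> Z \<subseteq> Domain (tile Y F i)" if "i < m" for i
  proof
    fix x assume "x \<in> F \<inter> Z"
    then have "x \<in> packed Y F m" "x \<in> F" using Z by auto
    then show "x \<in> Domain (tile Y F i)" using that orb_refl unfolding packed_def by auto
  qed
  show "Range (tile Y F i) \<subseteq> Y" for i using tile_sub by blast
qed (use tile_disj tile_pinj[OF L F Y] in auto)

text \<open>On an orbit where tile \<open>i\<close> leaves a point of \<open>F\<close> unmatched,
  maximality means that it used every point of \<open>Y\<close> left over by the earlier tiles. So
  the first \<open>i + 1\<close> tiles, hence the first \<open>m\<close>, already cover.\<close>

lemma covers_not_packed:
  assumes L: "invariant_algebra L" and F: "F \<in> L" and Y: "Y \<in> L" and Z: "Z \<inter> packed Y F m = {}"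
  shows "covers L F Y Z m"
  unfolding covers_def
proof (intro exI[of _ "tile Y F"] conjI allI impI)
  show "Domain (tile Y F i) \<subseteq> F" for i using tile_sub by blast
  show "Y \<inter> Z \<subseteq> (\<Union>j<m. Range (tile Y F j))"
  proof
    fix y assume y: "y \<in> Y \<inter> Z"
    then have y\<Omega>: "y \<in> \<Omega>" using ia_sub[OF L Y] by blast
    have "y \<notin> packed Y F m" using y Z by blast
    then obtain i x where i: "i < m" and x: "x \<in> F" "x \<in> orb y" "x \<notin> Domain (tile Y F i)"
      using y\<Omega> unfolding packed_def by auto
    have x\<Omega>: "x \<in> \<Omega>" using x(2) y\<Omega> by (rule orb_sub)
    have yx: "y \<in> orb x" using orb_eq[OF x(2) y\<Omega>] y\<Omega> by simp
    have "y \<in> used Y F (Suc i)"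
    proof (cases "y \<in> used Y F i")
      case False
      then have "y \<in> Range (greedy F (Y - used Y F i))"
        using greedy_maximal[OF x(1) x\<Omega> _ yx] x(3) y unfolding tile_def by blast
      then show ?thesis by simp
    qed simp
    then show "y \<in> (\<Union>j<m. Range (tile Y F j))" unfolding used_eq using i by force
  qed
qed (use tile_pinj[OF L F Y] in auto)

lemma packs_union:
  assumes P: "packs L F P Z a" and Q: "packs L F Q Z b" and PQ: "P \<inter> Q = {}"
  shows "packs L F (P \<union> Q) Z (a + b)"
proof -
  obtain \<mu> where \<mu>: "\<And>i. i < a \<Longrightarrow> pinj L (\<mu> i) \<and> F \<inter> Z \<subseteq> Domain (\<mu> i) \<and> Range (\<mu> i) \<subseteq> P"
    "\<And>i j. i < a \<Longrightarrow> j < a \<Longrightarrow> i \<noteq> j \<Longrightarrow> Range (\<mu> i) \<inter> Range (\<mu> j) = {}"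
    using P unfolding packs_def by metis
  obtain \<nu> where \<nu>: "\<And>i. i < b \<Longrightarrow> pinj L (\<nu> i) \<and> F \<inter> Z \<subseteq> Domain (\<nu> i) \<and> Range (\<nu> i) \<subseteq> Q"
    "\<And>i j. i < b \<Longrightarrow> j < b \<Longrightarrow> i \<noteq> j \<Longrightarrow> Range (\<nu> i) \<inter> Range (\<nu> j) = {}"
    using Q unfolding packs_def by metis
  let ?\<rho> = "\<lambda>i. if i < a then \<mu> i else \<nu> (i - a)"
  show ?thesis unfolding packs_def
  proof (intro exI[of _ ?\<rho>] conjI allI impI)
    fix i assume i: "i < a + b"
    show "pinj L (?\<rho> i)" "F \<inter> Z \<subseteq> Domain (?\<rho> i)"
      using i \<mu>(1)[of i] \<nu>(1)[of "i - a"] by auto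
    show "Range (?\<rho> i) \<subseteq> P \<union> Q"
      using i \<mu>(1)[of i] \<nu>(1)[of "i - a"] 
    proof (cases "i < a")
      case False
      then have "i - a < b" using i by auto
      then have "Range (\<nu> (i - a)) \<subseteq> Q" using \<nu>(1) by blast
      then show ?thesis using False by auto
    qed auto
    fix j assume j: "j < a + b" "i \<noteq> j"
    show "Range (?\<rho> i) \<inter> Range (?\<rho> j) = {}"
    proof (cases "i < a"; cases "j < a")
      assume "i < a" "j < a" then show ?thesis using \<mu>(2)[of i j] j by simp
    next
      assume "i < a" "\<not> j < a"
      then have "Range (?\<rho> i) \<subseteq> P" "Range (?\<rho> j) \<subseteq> Q" using \<mu>(1)[of i] \<nu>(1)[of "j - a"] j by auto
      then show ?thesis using PQ by blast
    next
      assume "\<not> i < a" "j < a"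
      then have "Range (?\<rho> i) \<subseteq> Q" "Range (?\<rho> j) \<subseteq> P" using \<mu>(1)[of j] \<nu>(1)[of "i - a"] i by auto
      then show ?thesis using PQ by blast
    next
      assume "\<not> i < a" "\<not> j < a" then show ?thesis using \<nu>(2)[of "i - a" "j - a"] i j by simp
    qed
  qed
qed

text \<open>The maps stay inside orbits, so a point starting in the invariant set \<open>Z\<close>
  lands in \<open>Y \<inter> Z\<close>; cutting the ranges down to \<open>Y'\<close> loses nothing
  there.\<close>

lemma packs_mono:
  assumes L: "invariant_algebra L" and P: "packs L F Y Z a" and Y': "Y' \<in> L"
    and Z: "invariant Z" and sub: "Y \<inter> Z \<subseteq> Y'"
  shows "packs L F Y' Z a"
proof -
  obtain \<mu> where \<mu>: "\<And>i. i < a \<Longrightarrow> pinj L (\<mu> i) \<and> F \<inter> Z \<subseteq> Domain (\<mu> i) \<and> Range (\<mu> i) \<subseteq> Y"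
    "\<And>i j. i < a \<Longrightarrow> j < a \<Longrightarrow> i \<noteq> j \<Longrightarrow> Range (\<mu> i) \<inter> Range (\<mu> j) = {}"
    using P unfolding packs_def by metis
  show ?thesis unfolding packs_def
  proof (intro exI[of _ "\<lambda>i. \<mu> i \<inter> \<Omega> \<times> Y'"] conjI allI impI)
    fix i assume i: "i < a"
    show "pinj L (\<mu> i \<inter> \<Omega> \<times> Y')" using \<mu>(1)[OF i] by (intro pinj_restrict[OF L] ia_space[OF L] Y') auto
    show "F \<inter> Z \<subseteq> Domain (\<mu> i \<inter> \<Omega> \<times> Y')"
    proof
      fix x assume x: "x \<in> F \<inter> Z"
      then obtain y where xy: "(x, y) \<in> \<mu> i" using \<mu>(1)[OF i] by blast
      have d: "drel L (\<mu> i)" using \<mu>(1)[OF i] pinj_drel by blast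
      have "y \<in> Z" using invariantD[OF Z drel_orb[OF L d xy] drel_dom[OF L d xy]] x by blast
      moreover have "y \<in> Y" using \<mu>(1)[OF i] xy by blast
      ultimately have "y \<in> Y'" using sub by blast
      then show "x \<in> Domain (\<mu> i \<inter> \<Omega> \<times> Y')" using xy drel_dom[OF L d xy] by blast
    qed
    show "Range (\<mu> i \<inter> \<Omega> \<times> Y') \<subseteq> Y'" by blast
    fix j assume "j < a" "i \<noteq> j"
    then show "Range (\<mu> i \<inter> \<Omega> \<times> Y') \<inter> Range (\<mu> j \<inter> \<Omega> \<times> Y') = {}"
      using \<mu>(2)[OF i, of j] by blast
  qed
qed

lemma packs_translates:
  assumes L: "invariant_algebra L" and F: "F \<in> L" and h: "\<And>i. i < m \<Longrightarrow> h i \<in> carrier G"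
    and A: "\<And>i. i < m \<Longrightarrow> \<phi> (h i) ` F \<subseteq> A"
    and disj: "\<And>i j. i < m \<Longrightarrow> j < m \<Longrightarrow> i \<noteq> j \<Longrightarrow> \<phi> (h i) ` F \<inter> \<phi> (h j) ` F = {}"
  shows "packs L F A Z m"
proof -
  have ran: "Range {(x, \<phi> (h i) x) | x. x \<in> F} = \<phi> (h i) ` F" for i by auto
  show ?thesis unfolding packs_def
    by (intro exI[of _ "\<lambda>i. {(x, \<phi> (h i) x) | x. x \<in> F}"] conjI allI impI, unfold ran)
       (use pinj_shift[OF L F h] A disj in auto)
qed

lemma covers_union:
  assumes P: "covers L F P Z a" and Q: "covers L F Q Z b"
  shows "covers L F (P \<union> Q) Z (a + b)"
proof -
  obtain \<mu> where \<mu>: "\<And>i. i < a \<Longrightarrow> pinj L (\<mu> i) \<and> Domain (\<mu> i) \<subseteq> F"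
    "P \<inter> Z \<subseteq> (\<Union>i<a. Range (\<mu> i))" using P unfolding covers_def by metis
  obtain \<nu> where \<nu>: "\<And>i. i < b \<Longrightarrow> pinj L (\<nu> i) \<and> Domain (\<nu> i) \<subseteq> F"
    "Q \<inter> Z \<subseteq> (\<Union>i<b. Range (\<nu> i))" using Q unfolding covers_def by metis
  let ?\<rho> = "\<lambda>i. if i < a then \<mu> i else \<nu> (i - a)"
  show ?thesis unfolding covers_def
  proof (intro exI[of _ ?\<rho>] conjI allI impI)
    fix i assume i: "i < a + b"
    show "pinj L (?\<rho> i)" "Domain (?\<rho> i) \<subseteq> F"
      using i \<mu>(1)[of i] \<nu>(1)[of "i - a"] by auto
  next
    show "(P \<union> Q) \<inter> Z \<subseteq> (\<Union>i<a + b. Range (?\<rho> i))"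
    proof
      fix y assume "y \<in> (P \<union> Q) \<inter> Z"
      then consider i where "i < a" "y \<in> Range (\<mu> i)" | i where "i < b" "y \<in> Range (\<nu> i)"
        using \<mu>(2) \<nu>(2) by blast
      then show "y \<in> (\<Union>i<a + b. Range (?\<rho> i))"
      proof cases
        case (1 i) then show ?thesis by (intro UN_I[of i]) auto
      next
        case (2 i) then show ?thesis by (intro UN_I[of "a + i"]) auto
      qed
    qed
  qed
qed

lemma covers_shift:
  assumes L: "invariant_algebra L" and C: "covers L F Y Z k" and Y: "Y \<subseteq> \<Omega>" and h: "h \<in> carrier G" and Z: "invariant Z"
  shows "covers L F (\<phi> h ` Y) Z k"
proof -
  obtain \<mu> where \<mu>: "\<And>i. i < k \<Longrightarrow> pinj L (\<mu> i) \<and> Domain (\<mu> i) \<subseteq> F"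
    "Y \<inter> Z \<subseteq> (\<Union>i<k. Range (\<mu> i))" using C unfolding covers_def by metis
  let ?S = "{(x, \<phi> h x) | x. x \<in> \<Omega>}"
  show ?thesis unfolding covers_def
  proof (intro exI[of _ "\<lambda>i. \<mu> i O ?S"] conjI allI impI)
    fix i assume i: "i < k"
    show "pinj L (\<mu> i O ?S)" using \<mu>(1)[OF i] by (intro pinj_comp[OF L] pinj_shift[OF L] ia_space[OF L] h) simp
    show "Domain (\<mu> i O ?S) \<subseteq> F" using \<mu>(1)[OF i] by blast
  next
    show "\<phi> h ` Y \<inter> Z \<subseteq> (\<Union>i<k. Range (\<mu> i O ?S))"
    proof
      fix z assume z: "z \<in> \<phi> h ` Y \<inter> Z"
      then obtain y where y: "y \<in> Y" "z = \<phi> h y" by blast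
      then have "y \<in> Z" using z Y invariant_act[OF Z h] by blast
      then obtain i where "i < k" "y \<in> Range (\<mu> i)" using y \<mu>(2) by blast
      then show "z \<in> (\<Union>i<k. Range (\<mu> i O ?S))" using y Y by blast
    qed
  qed
qed

lemma covers_prod:
  assumes L: "invariant_algebra L" and C: "covers L A Y Z c" and D: "covers L F A Z a" and Z: "invariant Z"
  shows "covers L F Y Z (c * a)"
proof -
  obtain \<mu> where \<mu>: "\<And>i. i < c \<Longrightarrow> pinj L (\<mu> i) \<and> Domain (\<mu> i) \<subseteq> A"
    "Y \<inter> Z \<subseteq> (\<Union>i<c. Range (\<mu> i))" using C unfolding covers_def by metis
  obtain \<nu> where \<nu>: "\<And>i. i < a \<Longrightarrow> pinj L (\<nu> i) \<and> Domain (\<nu> i) \<subseteq> F"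
    "A \<inter> Z \<subseteq> (\<Union>i<a. Range (\<nu> i))" using D unfolding covers_def by metis
  show ?thesis unfolding covers_def
  \<comment> \<open>The index encodes a pair: \<open>i mod a\<close> chooses a copy of
    \<open>F\<close> in the cover of \<open>A\<close>, and \<open>i div a\<close> a copy of
    \<open>A\<close> in the cover of \<open>Y\<close>.\<close>
  proof (intro exI[of _ "\<lambda>i. \<nu> (i mod a) O \<mu> (i div a)"] conjI allI impI)
    fix i assume "i < c * a"
    then have "i div a < c" "i mod a < a"
      by (auto simp: less_mult_imp_div_less) (metis gr_implies_not0 mod_less_divisor mult_0_right neq0_conv)
    then have 1: "pinj L (\<mu> (i div a))" "pinj L (\<nu> (i mod a))" "Domain (\<nu> (i mod a)) \<subseteq> F"
      using \<mu>(1) \<nu>(1) by auto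
    then show "pinj L (\<nu> (i mod a) O \<mu> (i div a))" "Domain (\<nu> (i mod a) O \<mu> (i div a)) \<subseteq> F"
      using pinj_comp[OF L] by auto
  next
    show "Y \<inter> Z \<subseteq> (\<Union>i<c * a. Range (\<nu> (i mod a) O \<mu> (i div a)))"
    proof
      fix y assume y: "y \<in> Y \<inter> Z"
      then obtain j x where j: "j < c" "(x, y) \<in> \<mu> j" using \<mu>(2) by blast
      have d: "drel L (\<mu> j)" using \<mu>(1)[OF j(1)] pinj_drel by blast
      have "x \<in> Z" using invariantD[OF Z drel_orb[OF L d j(2)] drel_dom[OF L d j(2)]] y by blast
      moreover have "x \<in> A" using \<mu>(1)[OF j(1)] j(2) by blast
      ultimately obtain i w where i: "i < a" "(w, x) \<in> \<nu> i" using \<nu>(2) by blast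
      let ?k = "j * a + i"
      have "?k div a = j" "?k mod a = i" using i(1) by auto
      moreover have "?k < c * a"
      proof -
        have "?k < Suc j * a" using i(1) by simp
        also have "\<dots> \<le> c * a" using j(1) by (intro mult_right_mono) auto
        finally show ?thesis .
      qed
      ultimately show "y \<in> (\<Union>i<c * a. Range (\<nu> (i mod a) O \<mu> (i div a)))"
        using i(2) j(2) by (intro UN_I[of ?k]) auto
    qed
  qed
qed

text \<open>The infinitely many tiles are themselves the coding maps: their ranges are disjoint, and
  every point of \<open>F\<close> in the orbit lies in all their domains.\<close>

lemma codable_all_packed:
  assumes L: "invariant_algebra L" and F: "F \<in> L" and Y: "Y \<in> L"
    and Z: "Z \<subseteq> sat F" "\<And>m. Z \<subseteq> packed Y F m"
  shows "codable L Z"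
proof (rule codableI[OF L tile_pinj[OF L F Y]])
  show "Range (tile Y F n) \<inter> Range (tile Y F m) = {}" if "n \<noteq> m" for n m using tile_disj that .
  fix x assume x: "x \<in> Z"
  then obtain y where "y \<in> orb x" "y \<in> F" "x \<in> \<Omega>" using Z(1) unfolding sat_def by auto
  moreover have "F \<inter> orb x \<subseteq> Domain (tile Y F n)" for n
    using Z(2)[of "Suc n"] x unfolding packed_def by auto
  ultimately show "x \<in> \<Omega> \<and> (\<exists>y\<in>orb x. \<forall>n. y \<in> Domain (tile Y F n))" by blast
qed

text \<open>A Hilbert hotel. Each point of \<open>Y\<close> is taken back to \<open>F\<close> along
  a covering map and forward again along a packing map. As \<open>k < m\<close>, one packing map can
  be left out, so this sends \<open>Y\<close> injectively into itself off one copy of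
  \<open>F\<close>; the iterates of that copy are pairwise disjoint.\<close>

lemma codable_packs_covers:
  assumes L: "invariant_algebra L" and F: "F \<in> L" and Y: "Y \<in> L" and Z: "invariant Z" "Z \<subseteq> sat F"
    and P: "packs L F Y Z m" and C: "covers L F Y Z k" and "k < m"
  shows "codable L Z"
proof -
  obtain \<mu> where \<mu>: "\<And>i. i < m \<Longrightarrow> pinj L (\<mu> i) \<and> F \<inter> Z \<subseteq> Domain (\<mu> i) \<and> Range (\<mu> i) \<subseteq> Y"
    "\<And>i j. i < m \<Longrightarrow> j < m \<Longrightarrow> i \<noteq> j \<Longrightarrow> Range (\<mu> i) \<inter> Range (\<mu> j) = {}"
    using P unfolding packs_def by metis
  obtain \<nu> where \<nu>: "\<And>i. i < k \<Longrightarrow> pinj L (\<nu> i) \<and> Domain (\<nu> i) \<subseteq> F"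
    "Y \<inter> Z \<subseteq> (\<Union>i<k. Range (\<nu> i))" using C unfolding covers_def by metis
  have \<mu>p: "pinj L (\<mu> i)" if "i < m" for i using \<mu>(1)[OF that] by simp
  have \<nu>p: "pinj L (\<nu> i)" if "i < k" for i using \<nu>(1)[OF that] by simp
  \<comment> \<open>Covering ranges may overlap; assigning each point to the first range containing
    it makes the return to \<open>F\<close> single-valued.\<close>
  define B where "B j = Range (\<nu> j) - (\<Union>i<j. Range (\<nu> i))" for j
  have BL: "B j \<in> L" if "j < k" for j
    unfolding B_def by (intro ia_Diff[OF L] ia_UN[OF L] drel_Range[OF L] pinj_drel \<nu>p) (use that in auto)
  have Bdisj: "i = j" if "y \<in> B i" "y \<in> B j" for i j y
    using that unfolding B_def by (metis Diff_iff UN_I lessThan_iff linorder_neqE_nat)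
  \<comment> \<open>The shift to \<open>Suc j\<close> keeps the copy given by \<open>\<mu> 0\<close>
    out of the range; the index stays below \<open>m\<close> because
    \<open>j < k < m\<close>.\<close>
  define S where "S j = ((\<nu> j)\<inverse> \<inter> B j \<times> \<Omega>) O \<mu> (Suc j)" for j
  define R where "R = (\<Union>j<k. S j)"
  have Sp: "pinj L (S j)" if "j < k" for j
  proof -
    have "pinj L ((\<nu> j)\<inverse>)" using \<nu>p[OF that] drel_converse[OF L] unfolding pinj_def by simp
    then show ?thesis unfolding S_def using that \<open>k < m\<close>
      by (intro pinj_comp[OF L] pinj_restrict[OF L] BL ia_space[OF L] \<mu>p) auto
  qed
  have Ssub: "S j \<subseteq> B j \<times> Range (\<mu> (Suc j))" for j unfolding S_def by blast
  have Rp: "pinj L R"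
  proof (rule pinjI)
    show "drel L R" unfolding R_def by (rule drel_UN[OF L]) (use pinj_drel[OF Sp] in auto)
    show "y = z" if yz: "(x, y) \<in> R" "(x, z) \<in> R" for x y z
    proof -
      obtain i j where ij: "i < k" "j < k" "(x, y) \<in> S i" "(x, z) \<in> S j" using yz unfolding R_def by blast
      then have "i = j" using Ssub[of i] Ssub[of j] Bdisj by blast
      then show ?thesis using ij pinj_fun[OF Sp] by blast
    qed
    show "x = y" if xy: "(x, z) \<in> R" "(y, z) \<in> R" for x y z
    proof -
      obtain i j where ij: "i < k" "j < k" "(x, z) \<in> S i" "(y, z) \<in> S j" using xy unfolding R_def by blast
      then have "z \<in> Range (\<mu> (Suc i)) \<inter> Range (\<mu> (Suc j))" using Ssub[of i] Ssub[of j] by blast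
      then have "i = j" using \<mu>(2)[of "Suc i" "Suc j"] ij \<open>k < m\<close> by auto
      then show ?thesis using ij pinj_inj[OF Sp] by blast
    qed
  qed
  have R0: "Range R \<inter> Range (\<mu> 0) = {}"
  proof -
    have "Range R \<subseteq> (\<Union>j<k. Range (\<mu> (Suc j)))" using Ssub unfolding R_def by blast
    moreover have "Range (\<mu> (Suc j)) \<inter> Range (\<mu> 0) = {}" if "j < k" for j
      using \<mu>(2)[of "Suc j" 0] that \<open>k < m\<close> by simp
    ultimately show ?thesis by blast
  qed
  have Rtot: "\<exists>z. (y, z) \<in> R \<and> z \<in> Y \<inter> Z" if y: "y \<in> Y \<inter> Z" for y
  proof -
    have "\<exists>j. j < k \<and> y \<in> Range (\<nu> j)" using \<nu>(2) y by blast
    then have *: "(LEAST j. j < k \<and> y \<in> Range (\<nu> j)) < k \<and> y \<in> Range (\<nu> (LEAST j. j < k \<and> y \<in> Range (\<nu> j)))"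
      by (rule LeastI_ex)
    define j where "j = (LEAST j. j < k \<and> y \<in> Range (\<nu> j))"
    have j: "j < k" "y \<in> Range (\<nu> j)" using * unfolding j_def by auto
    have "y \<notin> Range (\<nu> i)" if "i < j" for i
      using not_less_Least[OF that[unfolded j_def]] that j(1) by auto
    then have yB: "y \<in> B j" unfolding B_def using j(2) by auto
    obtain x where x: "(x, y) \<in> \<nu> j" using j(2) by blast
    have d: "drel L (\<nu> j)" using \<nu>p[OF j(1)] by (rule pinj_drel)
    have x\<Omega>: "x \<in> \<Omega>" using drel_dom[OF L d x] .
    have "x \<in> Z" using invariantD[OF Z(1) drel_orb[OF L d x] x\<Omega>] y by blast
    moreover have "x \<in> F" using \<nu>(1)[OF j(1)] x by blast
    moreover have m: "Suc j < m" using j(1) \<open>k < m\<close> by simp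
    ultimately obtain z where z: "(x, z) \<in> \<mu> (Suc j)" using \<mu>(1)[OF m] by blast
    have d': "drel L (\<mu> (Suc j))" using \<mu>p[OF m] by (rule pinj_drel)
    have "z \<in> Z" using invariantD[OF Z(1) drel_orb[OF L d' z] x\<Omega>] \<open>x \<in> Z\<close> by blast
    moreover have "z \<in> Y" using \<mu>(1)[OF m] z by blast
    moreover have "(y, z) \<in> S j" unfolding S_def using x z yB x\<Omega> by blast
    ultimately show ?thesis using j(1) unfolding R_def by blast
  qed
  have 0: "0 < m" using \<open>k < m\<close> by simp
  let ?T = "\<lambda>n. \<mu> 0 O (Restr Id \<Omega> O R ^^ n)"
  show ?thesis
  proof (rule codableI[OF L])
    show "pinj L (?T n)" for n by (intro pinj_comp[OF L] pinj_relpow[OF L] \<mu>p 0 Rp)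
    \<comment> \<open>Cancelling \<open>n\<close> steps of the injective \<open>R\<close> would
      leave a point of \<open>Range (\<mu> 0)\<close> that lies in \<open>Range R\<close>.\<close>
    have disj: "Range (?T n) \<inter> Range (?T m) = {}" if "n < m" for n m
    proof (rule ccontr)
      assume "Range (?T n) \<inter> Range (?T m) \<noteq> {}"
      then obtain u v z where u: "u \<in> Range (\<mu> 0)" "(u, z) \<in> R ^^ n" and v: "(v, z) \<in> R ^^ m" by blast
      have "R ^^ m = R ^^ (m - n) O R ^^ n" using that relpow_add[of "m - n" n R] by simp
      then obtain w where w: "(v, w) \<in> R ^^ (m - n)" "(w, z) \<in> R ^^ n" using v by auto
      have inj: "(a, c) \<in> R ^^ n \<Longrightarrow> (b, c) \<in> R ^^ n \<Longrightarrow> a = b" for a b c n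
      proof (induction n arbitrary: c)
        case (Suc n)
        then obtain p q where "(a, p) \<in> R ^^ n" "(p, c) \<in> R" "(b, q) \<in> R ^^ n" "(q, c) \<in> R" by auto
        then show ?case using pinj_inj[OF Rp] Suc.IH by metis
      qed simp
      have "u = w" using inj u(2) w(2) .
      moreover obtain l where "m - n = Suc l" using \<open>n < m\<close> by (metis Suc_diff_Suc)
      ultimately have "u \<in> Range R" using w(1) by auto
      then show False using u(1) R0 by blast
    qed
    show "Range (?T n) \<inter> Range (?T m) = {}" if "n \<noteq> m" for n m
      using disj[of n m] disj[of m n] that by (cases "n < m") auto
    fix x assume x: "x \<in> Z"
    then obtain y where y: "y \<in> orb x" "y \<in> F" "x \<in> \<Omega>" using Z(2) unfolding sat_def by auto
    then have "y \<in> Z" using invariantD[OF Z(1)] x by blast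
    then obtain z where z: "(y, z) \<in> \<mu> 0" using \<mu>(1)[OF 0] y(2) by blast
    have d: "drel L (\<mu> 0)" using \<mu>p[OF 0] by (rule pinj_drel)
    have "z \<in> Z" using invariantD[OF Z(1) drel_orb[OF L d z] drel_dom[OF L d z]] \<open>y \<in> Z\<close> by blast
    then have zYZ: "z \<in> Y \<inter> Z" using \<mu>(1)[OF 0] z by blast
    have "\<exists>w. (z, w) \<in> R ^^ n \<and> w \<in> Y \<inter> Z" for n
    proof (induction n)
      case (Suc n)
      then show ?case using Rtot by (metis relpow_Suc_I)
    qed (use zYZ in simp)
    moreover have "z \<in> \<Omega>" using drel_ran[OF L d z] .
    ultimately have "y \<in> Domain (?T n)" for n using z by blast
    then show "x \<in> \<Omega> \<and> (\<exists>y\<in>orb x. \<forall>n. y \<in> Domain (?T n))" using y by blast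
  qed
qed

section \<open>Negligible sets and approximate additivity\<close>

text \<open>Only three Borel sets are allowed on each piece, since the final generator can afford
  a bounded number of them; this is why all estimates below are arranged to involve at most three sets at a time.\<close>

definition negligible :: "'a set \<Rightarrow> bool" where
  "negligible W \<longleftrightarrow> (\<exists>P Q F Z. (\<forall>j::nat. P j \<in> sets X \<and> Q j \<in> sets X \<and> F j \<in> sets X
     \<and> codable (gen_algebra {P j, Q j, F j}) (Z j)) \<and> W \<subseteq> (\<Union>j. Z j))"

definition generic :: "('a \<Rightarrow> bool) \<Rightarrow> bool" where
  "generic p \<longleftrightarrow> negligible {x \<in> \<Omega>. \<not> p x}"

lemma negligible_codable:
  assumes "P \<in> sets X" "Q \<in> sets X" "F \<in> sets X" "codable (gen_algebra {P, Q, F}) Z"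
  shows "negligible Z"
  unfolding negligible_def
  by (intro exI[of _ "\<lambda>_. P"] exI[of _ "\<lambda>_. Q"] exI[of _ "\<lambda>_. F"] exI[of _ "\<lambda>_. Z"]) (use assms in auto)

lemma negligible_subset: "negligible W \<Longrightarrow> V \<subseteq> W \<Longrightarrow> negligible V"
  unfolding negligible_def by (meson order_trans)

text \<open>Every piece keeps its own triple of sets, so a double sequence of pieces need only be
  reindexed as a single one; the merging of triples is postponed to
  \<open>codable_glue\<close>.\<close>

lemma negligible_UN:
  assumes "\<And>i::nat. negligible (W i)"
  shows "negligible (\<Union>i. W i)"
proof -
  let ?good = "\<lambda>i P Q F Z. (\<forall>j::nat. P j \<in> sets X \<and> Q j \<in> sets X \<and> F j \<in> sets X
     \<and> codable (gen_algebra {P j, Q j, F j}) (Z j)) \<and> W i \<subseteq> (\<Union>j. Z j)"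
  have "\<forall>i. \<exists>P Q F Z. ?good i P Q F Z" using assms unfolding negligible_def by blast
  then obtain P Q F Z where *: "\<And>i. ?good i (P i) (Q i) (F i) (Z i)" by metis
  let ?d = "\<lambda>f k. f (fst (prod_decode k)) (snd (prod_decode k))"
  have "(\<Union>i. W i) \<subseteq> (\<Union>k. ?d Z k)"
  proof
    fix x assume "x \<in> (\<Union>i. W i)"
    then obtain i j where "x \<in> Z i j" using * by blast
    then have "x \<in> ?d Z (prod_encode (i, j))" by simp
    then show "x \<in> (\<Union>k. ?d Z k)" by (rule UN_I[OF UNIV_I])
  qed
  then show ?thesis unfolding negligible_def using *
    by (intro exI[of _ "?d P"] exI[of _ "?d Q"] exI[of _ "?d F"] exI[of _ "?d Z"] conjI allI) simp_all
qed

lemma generic_mono: "generic p \<Longrightarrow> (\<And>x. x \<in> \<Omega> \<Longrightarrow> p x \<Longrightarrow> q x) \<Longrightarrow> generic q"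
  unfolding generic_def by (erule negligible_subset) blast

text \<open>Lets countably many rules hold at one point simultaneously. The type of \<open>i\<close>
  must be countable, which is why sets are later indexed by numbers and lists.\<close>

lemma generic_all:
  fixes p :: "'i::countable \<Rightarrow> 'a \<Rightarrow> bool"
  assumes "\<And>i. generic (p i)"
  shows "generic (\<lambda>x. \<forall>i. p i x)"
proof -
  have "negligible (\<Union>n. {x \<in> \<Omega>. \<not> p (from_nat n) x})"
    using assms unfolding generic_def by (rule negligible_UN)
  moreover have "{x \<in> \<Omega>. \<not> (\<forall>i. p i x)} \<subseteq> (\<Union>n. {x \<in> \<Omega>. \<not> p (from_nat n) x})"
    by (auto, metis from_nat_to_nat)
  ultimately show ?thesis unfolding generic_def by (rule negligible_subset)
qed

lemma generic_conj:
  assumes "generic p" "generic q"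
  shows "generic (\<lambda>x. p x \<and> q x)"
proof -
  have "generic (\<lambda>x. \<forall>b. (if b then p else q) x)"
    by (rule generic_all) (use assms in \<open>simp split: if_split\<close>)
  then show ?thesis by (rule generic_mono) (metis (full_types))
qed

lemma generic_true: "(\<And>x. x \<in> \<Omega> \<Longrightarrow> p x) \<Longrightarrow> generic p"
  unfolding generic_def
proof -
  assume "\<And>x. x \<in> \<Omega> \<Longrightarrow> p x"
  then have "{x \<in> \<Omega>. \<not> p x} = {}" by blast
  moreover have "codable (gen_algebra {{}, {}, {}}) {}"
    unfolding codable_def
    by (intro exI[of _ "\<lambda>_ _. {}"]) (auto simp: gen_basic)
  ultimately show "negligible {x \<in> \<Omega>. \<not> p x}" using negligible_codable[of "{}" "{}" "{}" "{}"] by (simp only: sets.empty_sets)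
qed

lemma generic_imp: "(c \<Longrightarrow> generic p) \<Longrightarrow> generic (\<lambda>x. c \<longrightarrow> p x)"
  by (cases c) (auto intro: generic_true)

section \<open>Collisions between packings and coverings, excluded up to negligible sets\<close>

lemma gen3:
  assumes "P \<in> sets X" "Q \<in> sets X" "F \<in> sets X"
  shows gen3_ia: "invariant_algebra (gen_algebra {P, Q, F})"
    and gen3_in: "P \<in> gen_algebra {P, Q, F}" "Q \<in> gen_algebra {P, Q, F}" "F \<in> gen_algebra {P, Q, F}"
proof -
  have s: "P \<subseteq> \<Omega>" "Q \<subseteq> \<Omega>" "F \<subseteq> \<Omega>" using assms sets.sets_into_space by auto
  show "invariant_algebra (gen_algebra {P, Q, F})" using s by (intro gen_invariant_algebra) simp
  show "P \<in> gen_algebra {P, Q, F}" "Q \<in> gen_algebra {P, Q, F}" "F \<in> gen_algebra {P, Q, F}"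
    using s by (auto intro: gen_basic)
qed

text \<open>The common scheme of the rules below: orbits violating a rule carry both a packing by
  \<open>m\<close> copies and a covering by \<open>k < m\<close>. The condition \<open>c\<close>
  only has to depend on the orbit; it need not define a Borel set.\<close>

lemma generic_packs_covers:
  assumes PQF: "P \<in> sets X" "Q \<in> sets X" "F \<in> sets X" and Y: "Y \<in> gen_algebra {P, Q, F}"
    and inv: "\<And>x y. x \<in> \<Omega> \<Longrightarrow> y \<in> orb x \<Longrightarrow> c y \<longleftrightarrow> c x"
    and pk: "\<And>Z. invariant Z \<Longrightarrow> (\<And>x. x \<in> Z \<Longrightarrow> c x) \<Longrightarrow> packs (gen_algebra {P, Q, F}) F Y Z m"
    and cv: "\<And>Z. invariant Z \<Longrightarrow> (\<And>x. x \<in> Z \<Longrightarrow> c x) \<Longrightarrow> covers (gen_algebra {P, Q, F}) F Y Z k"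
    and "k < m"
  shows "generic (\<lambda>x. x \<in> sat F \<longrightarrow> \<not> c x)"
proof -
  let ?Z = "{x \<in> sat F. c x}"
  have Z: "invariant ?Z"
  proof (rule invariantI)
    show \<Omega>: "x \<in> \<Omega>" if "x \<in> ?Z" for x using that by (simp add: sat_def)
    show "y \<in> ?Z" if "x \<in> ?Z" "y \<in> orb x" for x y
      using that inv[OF \<Omega>[OF that(1)] that(2)] sat_orb[OF that(2) \<Omega>[OF that(1)]] by simp
  qed
  have "codable (gen_algebra {P, Q, F}) ?Z"
  proof (rule codable_packs_covers[OF gen3_ia[OF PQF] gen3_in(3)[OF PQF] Y Z _ _ _ \<open>k < m\<close>])
    show "?Z \<subseteq> sat F" by blast
    show "packs (gen_algebra {P, Q, F}) F Y ?Z m" using Z by (rule pk) simp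
    show "covers (gen_algebra {P, Q, F}) F Y ?Z k" using Z by (rule cv) simp
  qed
  then have "negligible ?Z" by (rule negligible_codable[OF PQF])
  then show ?thesis unfolding generic_def by (rule negligible_subset) blast
qed

lemma generic_level:
  assumes Y: "Y \<in> sets X" and F: "F \<in> sets X"
  shows "generic (\<lambda>x. x \<in> sat F \<longrightarrow> (\<exists>m. x \<notin> packed Y F m))"
proof -
  note PQF = Y Y F
  have "codable (gen_algebra {Y, Y, F}) {x \<in> sat F. \<forall>m. x \<in> packed Y F m}"
    by (rule codable_all_packed[OF gen3_ia[OF PQF] gen3_in(3)[OF PQF] gen3_in(1)[OF PQF]]) auto
  then have "negligible {x \<in> sat F. \<forall>m. x \<in> packed Y F m}" by (rule negligible_codable[OF PQF])
  then show ?thesis unfolding generic_def by (rule negligible_subset) blast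
qed

text \<open>The tiles in \<open>P\<close> and those in \<open>Q\<close> together pack
  \<open>a + b\<close> copies into the union, while the failure of \<open>c\<close> tiles in the
  union provides a covering by \<open>c\<close> copies.\<close>

lemma generic_packed_union:
  assumes P: "P \<in> sets X" and Q: "Q \<in> sets X" and F: "F \<in> sets X" and PQ: "P \<inter> Q = {}" and c: "c < a + b"
  shows "generic (\<lambda>x. x \<in> sat F \<longrightarrow> \<not> (x \<in> packed P F a \<and> x \<in> packed Q F b \<and> x \<notin> packed (P \<union> Q) F c))"
proof (rule generic_packs_covers[OF P Q F _ _ _ _ c])
  note PQF = P Q F
  note g = gen3_ia[OF PQF] gen3_in[OF PQF]
  show U: "P \<union> Q \<in> gen_algebra {P, Q, F}" by (rule ia_Un[OF g(1-3)])
  fix Z assume Z: "\<And>x. x \<in> Z \<Longrightarrow> x \<in> packed P F a \<and> x \<in> packed Q F b \<and> x \<notin> packed (P \<union> Q) F c"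
  show "packs (gen_algebra {P, Q, F}) F (P \<union> Q) Z (a + b)"
    by (rule packs_union[OF packs_packed[OF g(1,4,2)] packs_packed[OF g(1,4,3)] PQ]) (use Z in auto)
  show "covers (gen_algebra {P, Q, F}) F (P \<union> Q) Z c"
    by (rule covers_not_packed[OF g(1,4) U]) (use Z in auto)
qed (simp add: packed_orb)

lemma generic_not_packed_union:
  assumes P: "P \<in> sets X" and Q: "Q \<in> sets X" and F: "F \<in> sets X" and c: "a + b < c"
  shows "generic (\<lambda>x. x \<in> sat F \<longrightarrow> \<not> (x \<notin> packed P F a \<and> x \<notin> packed Q F b \<and> x \<in> packed (P \<union> Q) F c))"
proof (rule generic_packs_covers[OF P Q F _ _ _ _ c])
  note PQF = P Q F
  note g = gen3_ia[OF PQF] gen3_in[OF PQF]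
  show U: "P \<union> Q \<in> gen_algebra {P, Q, F}" by (rule ia_Un[OF g(1-3)])
  fix Z assume Z: "\<And>x. x \<in> Z \<Longrightarrow> x \<notin> packed P F a \<and> x \<notin> packed Q F b \<and> x \<in> packed (P \<union> Q) F c"
  show "covers (gen_algebra {P, Q, F}) F (P \<union> Q) Z (a + b)"
    by (rule covers_union[OF covers_not_packed[OF g(1,4,2)] covers_not_packed[OF g(1,4,3)]]) (use Z in auto)
  show "packs (gen_algebra {P, Q, F}) F (P \<union> Q) Z c"
    by (rule packs_packed[OF g(1,4) U]) (use Z in auto)
qed (simp add: packed_orb)

lemma generic_packed_shift:
  assumes Y: "Y \<in> sets X" and F: "F \<in> sets X" and h: "h \<in> carrier G" and c: "a < c"
  shows "generic (\<lambda>x. x \<in> sat F \<longrightarrow> \<not> (x \<notin> packed Y F a \<and> x \<in> packed (\<phi> h ` Y) F c))"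
proof (rule generic_packs_covers[OF Y Y F _ _ _ _ c])
  note PQF = Y Y F
  note g = gen3_ia[OF PQF] gen3_in[OF PQF]
  show U: "\<phi> h ` Y \<in> gen_algebra {Y, Y, F}" by (rule ia_act[OF g(1) h g(2)])
  fix Z assume Zi: "invariant Z" and Z: "\<And>x. x \<in> Z \<Longrightarrow> x \<notin> packed Y F a \<and> x \<in> packed (\<phi> h ` Y) F c"
  show "packs (gen_algebra {Y, Y, F}) F (\<phi> h ` Y) Z c"
    by (rule packs_packed[OF g(1,4) U]) (use Z in auto)
  show "covers (gen_algebra {Y, Y, F}) F (\<phi> h ` Y) Z a"
    by (rule covers_shift[OF g(1) covers_not_packed[OF g(1,4,2)] ia_sub[OF g(1,2)] h Zi]) (use Z in auto)
qed (simp add: packed_orb)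

lemma generic_packed_mono:
  assumes Y: "Y \<in> sets X" and Y': "Y' \<in> sets X" and F: "F \<in> sets X" and c: "c < a"
  shows "generic (\<lambda>x. x \<in> sat F \<longrightarrow> \<not> (Y \<inter> orb x \<subseteq> Y' \<and> x \<in> packed Y F a \<and> x \<notin> packed Y' F c))"
proof (rule generic_packs_covers[OF Y Y' F _ _ _ _ c])
  note PQF = Y Y' F
  note g = gen3_ia[OF PQF] gen3_in[OF PQF]
  show "Y' \<in> gen_algebra {Y, Y', F}" by (rule g(3))
  fix Z assume Zi: "invariant Z"
    and Z: "\<And>x. x \<in> Z \<Longrightarrow> Y \<inter> orb x \<subseteq> Y' \<and> x \<in> packed Y F a \<and> x \<notin> packed Y' F c"
  have "Y \<inter> Z \<subseteq> Y'"
  proof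
    fix x assume x: "x \<in> Y \<inter> Z"
    then have "x \<in> orb x" using ia_sub[OF g(1,2)] by blast
    then show "x \<in> Y'" using Z[of x] x by blast
  qed
  from packs_packed[OF g(1,4,2)] g(3) Zi this show "packs (gen_algebra {Y, Y', F}) F Y' Z a"
    by (rule packs_mono[OF g(1)]) (use Z in auto)
  show "covers (gen_algebra {Y, Y', F}) F Y' Z c"
    by (rule covers_not_packed[OF g(1,4,3)]) (use Z in auto)
qed (simp add: packed_orb orb_eq)

lemma generic_packed_prod:
  assumes Y: "Y \<in> sets X" and A: "A \<in> sets X" and F: "F \<in> sets X" and c: "c * a < b"
  shows "generic (\<lambda>x. x \<in> sat F \<longrightarrow> \<not> (x \<notin> packed Y A c \<and> x \<notin> packed A F a \<and> x \<in> packed Y F b))"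
proof (rule generic_packs_covers[OF Y A F _ _ _ _ c])
  note PQF = Y A F
  note g = gen3_ia[OF PQF] gen3_in[OF PQF]
  show "Y \<in> gen_algebra {Y, A, F}" by (rule g(2))
  fix Z assume Zi: "invariant Z"
    and Z: "\<And>x. x \<in> Z \<Longrightarrow> x \<notin> packed Y A c \<and> x \<notin> packed A F a \<and> x \<in> packed Y F b"
  show "packs (gen_algebra {Y, A, F}) F Y Z b"
    by (rule packs_packed[OF g(1,4,2)]) (use Z in auto)
  show "covers (gen_algebra {Y, A, F}) F Y Z (c * a)"
    by (rule covers_prod[OF g(1) covers_not_packed[OF g(1,3,2)] covers_not_packed[OF g(1,4,3)] Zi]) (use Z in auto)
qed (simp add: packed_orb)

lemma generic_packed_translates:
  assumes A: "A \<in> sets X" and F: "F \<in> sets X" and h: "\<And>i. i < m \<Longrightarrow> h i \<in> carrier G"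
    and FA: "\<And>i. i < m \<Longrightarrow> \<phi> (h i) ` F \<subseteq> A"
    and disj: "\<And>i j. i < m \<Longrightarrow> j < m \<Longrightarrow> i \<noteq> j \<Longrightarrow> \<phi> (h i) ` F \<inter> \<phi> (h j) ` F = {}"
    and c: "c < m"
  shows "generic (\<lambda>x. x \<in> sat F \<longrightarrow> \<not> x \<notin> packed A F c)"
proof (rule generic_packs_covers[OF A A F _ _ _ _ c])
  note PQF = A A F
  note g = gen3_ia[OF PQF] gen3_in[OF PQF]
  show "A \<in> gen_algebra {A, A, F}" by (rule g(2))
  fix Z assume Zi: "invariant Z" and Z: "\<And>x. x \<in> Z \<Longrightarrow> x \<notin> packed A F c"
  show "packs (gen_algebra {A, A, F}) F A Z m"
    by (rule packs_translates[OF g(1,4) h FA disj])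
  show "covers (gen_algebra {A, A, F}) F A Z c"
    by (rule covers_not_packed[OF g(1,4,2)]) (use Z in auto)
qed (simp add: packed_orb)

section \<open>The number of copies that fit, as an approximately additive quantity\<close>

definition level :: "'a set \<Rightarrow> 'a set \<Rightarrow> 'a \<Rightarrow> nat" where
  "level Y F x = (LEAST i. x \<notin> packed Y F (Suc i))"

lemma packed_level:
  assumes "x \<in> \<Omega>" "\<exists>m. x \<notin> packed Y F m"
  shows "x \<in> packed Y F m \<longleftrightarrow> m \<le> level Y F x"
proof -
  have anti: "packed Y F n \<subseteq> packed Y F m" if "m \<le> n" for m n using that less_le_trans unfolding packed_def by blast
  have 0: "x \<in> packed Y F 0" using assms(1) by (simp add: packed_def)
  obtain i where "x \<notin> packed Y F (Suc i)" using assms(2) 0 by (metis not0_implies_Suc)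
  then have 1: "x \<notin> packed Y F (Suc (level Y F x))" unfolding level_def by (rule LeastI)
  have 2: "x \<in> packed Y F (level Y F x)"
  proof (cases "level Y F x")
    case (Suc k)
    then have "k < level Y F x" by simp
    then have "x \<in> packed Y F (Suc k)" unfolding level_def using not_less_Least by blast
    then show ?thesis using Suc by simp
  qed (use 0 in simp)
  show ?thesis using 1 2 anti[of m "level Y F x"] anti[of "Suc (level Y F x)" m]
    by (cases "m \<le> level Y F x") auto
qed

text \<open>If every tile fits, the \<open>LEAST\<close> in \<open>level\<close> is unspecified;
  those orbits are discarded by \<open>generic_level\<close>. This is the source of the meaning of
  \<open>level\<close> in the rules that follow.\<close>

lemma generic_level_iff:
  assumes Y: "Y \<in> sets X" and F: "F \<in> sets X"
  shows "generic (\<lambda>x. x \<in> sat F \<longrightarrow> (\<forall>m. x \<in> packed Y F m \<longleftrightarrow> m \<le> level Y F x))"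
  by (rule generic_mono[OF generic_level[OF Y F]]) (use packed_level in blast)

text \<open>A set of level \<open>l\<close> packs \<open>l\<close> copies and is covered by
  \<open>l + 1\<close>. Comparing packings of the two parts with one covering of the union gives the
  error 1.\<close>

lemma level_union_ge:
  assumes P: "P \<in> sets X" and Q: "Q \<in> sets X" and F: "F \<in> sets X" and PQ: "P \<inter> Q = {}"
  shows "generic (\<lambda>x. x \<in> sat F \<longrightarrow> level P F x + level Q F x \<le> level (P \<union> Q) F x + 1)"
proof -
  have U: "P \<union> Q \<in> sets X" using P Q by simp
  have "generic (\<lambda>x. \<forall>a b c. c < a + b \<longrightarrow> x \<in> sat F \<longrightarrow>
      \<not> (x \<in> packed P F a \<and> x \<in> packed Q F b \<and> x \<notin> packed (P \<union> Q) F c))"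
    by (intro generic_all generic_imp generic_packed_union[OF P Q F PQ])
  note this[THEN generic_conj, OF generic_conj[OF generic_level_iff[OF P F] generic_conj[OF generic_level_iff[OF Q F] generic_level_iff[OF U F]]]]
  then show ?thesis
  proof (rule generic_mono, intro impI)
    fix x
    assume *: "(\<forall>a b c. c < a + b \<longrightarrow> x \<in> sat F \<longrightarrow>
      \<not> (x \<in> packed P F a \<and> x \<in> packed Q F b \<and> x \<notin> packed (P \<union> Q) F c))
      \<and> (x \<in> sat F \<longrightarrow> (\<forall>m. x \<in> packed P F m \<longleftrightarrow> m \<le> level P F x))
      \<and> (x \<in> sat F \<longrightarrow> (\<forall>m. x \<in> packed Q F m \<longleftrightarrow> m \<le> level Q F x))
      \<and> (x \<in> sat F \<longrightarrow> (\<forall>m. x \<in> packed (P \<union> Q) F m \<longleftrightarrow> m \<le> level (P \<union> Q) F x))"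
      and x: "x \<in> sat F"
    have "\<not> level (P \<union> Q) F x + 1 < level P F x + level Q F x"
      using spec[OF spec[OF spec[OF conjunct1[OF *], of "level P F x"], of "level Q F x"], of "level (P \<union> Q) F x + 1"] conjunct2[OF *] x by simp
    then show "level P F x + level Q F x \<le> level (P \<union> Q) F x + 1" by simp
  qed
qed

text \<open>Here two coverings are joined, each one larger than the corresponding level, which gives
  the error 2.\<close>

lemma level_union_le:
  assumes P: "P \<in> sets X" and Q: "Q \<in> sets X" and F: "F \<in> sets X"
  shows "generic (\<lambda>x. x \<in> sat F \<longrightarrow> level (P \<union> Q) F x \<le> level P F x + level Q F x + 2)"
proof -
  have U: "P \<union> Q \<in> sets X" using P Q by simp
  have "generic (\<lambda>x. \<forall>a b c. a + b < c \<longrightarrow> x \<in> sat F \<longrightarrow>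
      \<not> (x \<notin> packed P F a \<and> x \<notin> packed Q F b \<and> x \<in> packed (P \<union> Q) F c))"
    by (intro generic_all generic_imp generic_not_packed_union[OF P Q F])
  note this[THEN generic_conj, OF generic_conj[OF generic_level_iff[OF P F] generic_conj[OF generic_level_iff[OF Q F] generic_level_iff[OF U F]]]]
  then show ?thesis
  proof (rule generic_mono, intro impI)
    fix x
    assume *: "(\<forall>a b c. a + b < c \<longrightarrow> x \<in> sat F \<longrightarrow>
      \<not> (x \<notin> packed P F a \<and> x \<notin> packed Q F b \<and> x \<in> packed (P \<union> Q) F c))
      \<and> (x \<in> sat F \<longrightarrow> (\<forall>m. x \<in> packed P F m \<longleftrightarrow> m \<le> level P F x))
      \<and> (x \<in> sat F \<longrightarrow> (\<forall>m. x \<in> packed Q F m \<longleftrightarrow> m \<le> level Q F x))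
      \<and> (x \<in> sat F \<longrightarrow> (\<forall>m. x \<in> packed (P \<union> Q) F m \<longleftrightarrow> m \<le> level (P \<union> Q) F x))"
      and x: "x \<in> sat F"
    have "\<not> level P F x + 1 + (level Q F x + 1) < level (P \<union> Q) F x"
      using spec[OF spec[OF spec[OF conjunct1[OF *], of "level P F x + 1"], of "level Q F x + 1"], of "level (P \<union> Q) F x"] conjunct2[OF *] x by auto
    then show "level (P \<union> Q) F x \<le> level P F x + level Q F x + 2" by simp
  qed
qed

lemma level_shift:
  assumes Y: "Y \<in> sets X" and F: "F \<in> sets X" and h: "h \<in> carrier G"
  shows "generic (\<lambda>x. x \<in> sat F \<longrightarrow> level (\<phi> h ` Y) F x \<le> level Y F x + 1)"
proof -
  have hY: "\<phi> h ` Y \<in> sets X" using act_measurable[OF h Y] .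
  have "generic (\<lambda>x. \<forall>a c. a < c \<longrightarrow> x \<in> sat F \<longrightarrow> \<not> (x \<notin> packed Y F a \<and> x \<in> packed (\<phi> h ` Y) F c))"
    by (intro generic_all generic_imp generic_packed_shift[OF Y F h])
  note this[THEN generic_conj, OF generic_conj[OF generic_level_iff[OF Y F] generic_level_iff[OF hY F]]]
  then show ?thesis
  proof (rule generic_mono, intro impI)
    fix x
    assume *: "(\<forall>a c. a < c \<longrightarrow> x \<in> sat F \<longrightarrow> \<not> (x \<notin> packed Y F a \<and> x \<in> packed (\<phi> h ` Y) F c))
      \<and> (x \<in> sat F \<longrightarrow> (\<forall>m. x \<in> packed Y F m \<longleftrightarrow> m \<le> level Y F x))
      \<and> (x \<in> sat F \<longrightarrow> (\<forall>m. x \<in> packed (\<phi> h ` Y) F m \<longleftrightarrow> m \<le> level (\<phi> h ` Y) F x))"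
      and x: "x \<in> sat F"
    have "\<not> level Y F x + 1 < level (\<phi> h ` Y) F x"
      using spec[OF spec[OF conjunct1[OF *], of "level Y F x + 1"], of "level (\<phi> h ` Y) F x"] conjunct2[OF *] x by auto
    then show "level (\<phi> h ` Y) F x \<le> level Y F x + 1" by simp
  qed
qed

text \<open>Inclusion is demanded only on the orbit of \<open>x\<close>. This is what later replaces
  an infinite union by a finite one whose length depends on the orbit.\<close>

lemma level_mono:
  assumes Y: "Y \<in> sets X" and Y': "Y' \<in> sets X" and F: "F \<in> sets X"
  shows "generic (\<lambda>x. x \<in> sat F \<longrightarrow> Y \<inter> orb x \<subseteq> Y' \<longrightarrow> level Y F x \<le> level Y' F x + 1)"
proof -
  have "generic (\<lambda>x. \<forall>a c. c < a \<longrightarrow> x \<in> sat F \<longrightarrow>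
      \<not> (Y \<inter> orb x \<subseteq> Y' \<and> x \<in> packed Y F a \<and> x \<notin> packed Y' F c))"
    by (intro generic_all generic_imp generic_packed_mono[OF Y Y' F])
  note this[THEN generic_conj, OF generic_conj[OF generic_level_iff[OF Y F] generic_level_iff[OF Y' F]]]
  then show ?thesis
  proof (rule generic_mono, intro impI)
    fix x
    assume *: "(\<forall>a c. c < a \<longrightarrow> x \<in> sat F \<longrightarrow>
      \<not> (Y \<inter> orb x \<subseteq> Y' \<and> x \<in> packed Y F a \<and> x \<notin> packed Y' F c))
      \<and> (x \<in> sat F \<longrightarrow> (\<forall>m. x \<in> packed Y F m \<longleftrightarrow> m \<le> level Y F x))
      \<and> (x \<in> sat F \<longrightarrow> (\<forall>m. x \<in> packed Y' F m \<longleftrightarrow> m \<le> level Y' F x))"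
      and x: "x \<in> sat F" "Y \<inter> orb x \<subseteq> Y'"
    have "\<not> level Y' F x + 1 < level Y F x"
      using spec[OF spec[OF conjunct1[OF *], of "level Y F x"], of "level Y' F x + 1"] conjunct2[OF *] x by simp
    then show "level Y F x \<le> level Y' F x + 1" by simp
  qed
qed

text \<open>Covering numbers multiply, and each is one more than a level. The condition
  \<open>x \<in> sat A\<close> is what gives \<open>level Y A x\<close> its meaning.\<close>

lemma level_prod:
  assumes Y: "Y \<in> sets X" and A: "A \<in> sets X" and F: "F \<in> sets X"
  shows "generic (\<lambda>x. x \<in> sat F \<longrightarrow> x \<in> sat A \<longrightarrow> level Y F x \<le> (level Y A x + 1) * (level A F x + 1))"
proof -
  have "generic (\<lambda>x. \<forall>a b c. c * a < b \<longrightarrow> x \<in> sat F \<longrightarrow>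
      \<not> (x \<notin> packed Y A c \<and> x \<notin> packed A F a \<and> x \<in> packed Y F b))"
    by (intro generic_all generic_imp generic_packed_prod[OF Y A F])
  note this[THEN generic_conj, OF generic_conj[OF generic_level_iff[OF Y A] generic_conj[OF generic_level_iff[OF A F] generic_level_iff[OF Y F]]]]
  then show ?thesis
  proof (rule generic_mono, intro impI)
    fix x
    assume *: "(\<forall>a b c. c * a < b \<longrightarrow> x \<in> sat F \<longrightarrow>
      \<not> (x \<notin> packed Y A c \<and> x \<notin> packed A F a \<and> x \<in> packed Y F b))
      \<and> (x \<in> sat A \<longrightarrow> (\<forall>m. x \<in> packed Y A m \<longleftrightarrow> m \<le> level Y A x))
      \<and> (x \<in> sat F \<longrightarrow> (\<forall>m. x \<in> packed A F m \<longleftrightarrow> m \<le> level A F x))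
      \<and> (x \<in> sat F \<longrightarrow> (\<forall>m. x \<in> packed Y F m \<longleftrightarrow> m \<le> level Y F x))"
      and x: "x \<in> sat F" "x \<in> sat A"
    have "\<not> (level Y A x + 1) * (level A F x + 1) < level Y F x"
      using spec[OF spec[OF spec[OF conjunct1[OF *], of "level A F x + 1"], of "level Y F x"], of "level Y A x + 1"] conjunct2[OF *] x by (simp del: mult_Suc mult_Suc_right)
    then show "level Y F x \<le> (level Y A x + 1) * (level A F x + 1)" by simp
  qed
qed

lemma level_translates:
  assumes A: "A \<in> sets X" and F: "F \<in> sets X" and h: "\<And>i. i < m \<Longrightarrow> h i \<in> carrier G"
    and FA: "\<And>i. i < m \<Longrightarrow> \<phi> (h i) ` F \<subseteq> A"
    and disj: "\<And>i j. i < m \<Longrightarrow> j < m \<Longrightarrow> i \<noteq> j \<Longrightarrow> \<phi> (h i) ` F \<inter> \<phi> (h j) ` F = {}"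
  shows "generic (\<lambda>x. x \<in> sat F \<longrightarrow> m \<le> level A F x + 1)"
proof -
  have "generic (\<lambda>x. \<forall>c. c < m \<longrightarrow> x \<in> sat F \<longrightarrow> \<not> x \<notin> packed A F c)"
    by (intro generic_all generic_imp generic_packed_translates[OF A F h FA disj])
  note this[THEN generic_conj, OF generic_level_iff[OF A F]]
  then show ?thesis
  proof (rule generic_mono, intro impI)
    fix x
    assume *: "(\<forall>c. c < m \<longrightarrow> x \<in> sat F \<longrightarrow> \<not> x \<notin> packed A F c)
      \<and> (x \<in> sat F \<longrightarrow> (\<forall>m. x \<in> packed A F m \<longleftrightarrow> m \<le> level A F x))" and x: "x \<in> sat F"
    have "\<not> level A F x + 1 < m" using spec[OF conjunct1[OF *], of "level A F x + 1"] conjunct2[OF *] x by auto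
    then show "m \<le> level A F x + 1" by simp
  qed
qed

section \<open>From negligibility to a generator\<close>

lemma act_image_Int:
  assumes Z: "invariant Z" and g: "g \<in> carrier G" and A: "A \<subseteq> \<Omega>" "A' \<subseteq> \<Omega>" and eq: "A \<inter> Z = A' \<inter> Z"
  shows "\<phi> g ` A \<inter> Z = \<phi> g ` A' \<inter> Z"
proof -
  have "\<phi> (inv g) y \<in> A \<longleftrightarrow> \<phi> (inv g) y \<in> A'" if "y \<in> Z" "y \<in> \<Omega>" for y
    using invariant_act[OF Z inv_closed[OF g] that(2)] that(1) eq by blast
  then show ?thesis using mem_act_image[OF g A(1)] mem_act_image[OF g A(2)] by blast
qed

lemma sat_Int:
  assumes Z: "invariant Z" and eq: "A \<inter> Z = A' \<inter> Z"
  shows "sat A \<inter> Z = sat A' \<inter> Z"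
proof -
  have "orb x \<inter> A = orb x \<inter> A'" if "x \<in> Z" for x
  proof -
    have "orb x \<subseteq> Z" using Z that unfolding invariant_def by simp
    then show ?thesis using eq by blast
  qed
  then show ?thesis unfolding sat_def by auto
qed

text \<open>Translation, complement and countable union are all compatible with restriction to an
  invariant set, so equal traces of the generators propagate. The set \<open>Z\<close> itself may
  lie outside both algebras, the situation met in \<open>codable_glue\<close>.\<close>

lemma gen_trace:
  assumes Z: "invariant Z" and S: "S \<subseteq> Pow \<Omega>" and S': "S' \<subseteq> Pow \<Omega>"
    and tr: "\<And>A. A \<in> S \<Longrightarrow> \<exists>A'\<in>S'. A \<inter> Z = A' \<inter> Z" and A: "A \<in> gen_algebra S"
  shows "\<exists>A'\<in>gen_algebra S'. A \<inter> Z = A' \<inter> Z"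
proof -
  note L = gen_invariant_algebra[OF S']
  show ?thesis using A[unfolded gen_algebra_def]
  proof (induction rule: sigma_sets.induct)
    case (Basic a)
    then obtain g B where g: "g \<in> carrier G" "B \<in> S" "a = \<phi> g ` B" by auto
    obtain B' where B': "B' \<in> S'" "B \<inter> Z = B' \<inter> Z" using tr[OF g(2)] by auto
    have sub: "B \<subseteq> \<Omega>" "B' \<subseteq> \<Omega>" using S S' g B' by auto
    have "\<phi> g ` B' \<in> gen_algebra S'" by (rule ia_act[OF L g(1) gen_basic[OF B'(1) sub(2)]])
    then show ?case using act_image_Int[OF Z g(1) sub B'(2)] g(3) by (intro bexI[of _ "\<phi> g ` B'"]) simp_all
  next
    case Empty
    show ?case by (rule bexI[OF refl ia_empty[OF L]])
  next
    case (Compl a)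
    then obtain a' where a': "a' \<in> gen_algebra S'" "a \<inter> Z = a' \<inter> Z" by (elim bexE)
    show ?case by (rule bexI[OF _ ia_Diff[OF L ia_space[OF L] a'(1)]]) (use a'(2) in blast)
  next
    case (Union a)
    have "\<exists>b. \<forall>i. b i \<in> gen_algebra S' \<and> a i \<inter> Z = b i \<inter> Z"
      by (rule choice, rule allI) (use Union.IH in \<open>simp add: Bex_def\<close>)
    then obtain b where b: "\<And>i. b i \<in> gen_algebra S'" "\<And>i. a i \<inter> Z = b i \<inter> Z" by metis
    have "(\<Union>i. b i) \<in> gen_algebra S'" using b(1) by (intro ia_UN[OF L]) simp_all
    moreover have "(\<Union>i. a i) \<inter> Z = (\<Union>i. b i) \<inter> Z" using b(2) by blast
    ultimately show ?case by (rule bexI[rotated])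
  qed
qed

lemma bad_iff:
  "x \<in> bad M \<longleftrightarrow>
     (\<exists>n. \<exists>g\<in>carrier G. \<exists>h\<in>carrier G. g \<noteq> h \<and> x \<in> M n g \<and> x \<in> M n h)
   \<or> (\<exists>n m. \<exists>g\<in>carrier G. \<exists>h\<in>carrier G. (n, g) \<noteq> (m, h) \<and> x \<in> \<phi> g ` M n g \<and> x \<in> \<phi> h ` M m h)"
  unfolding bad_def by (simp add: Bex_def split_paired_Ex del: image_iff) meson

text \<open>Whether an orbit is well coded depends only on what the system does on that
  orbit.\<close>

lemma code_dom_Int:
  assumes Z: "invariant Z" and sub: "\<And>n g. g \<in> carrier G \<Longrightarrow> M n g \<subseteq> \<Omega>" "\<And>n g. g \<in> carrier G \<Longrightarrow> M' n g \<subseteq> \<Omega>"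
    and eq: "\<And>n g. g \<in> carrier G \<Longrightarrow> M n g \<inter> Z = M' n g \<inter> Z"
  shows "code_dom M \<inter> Z = code_dom M' \<inter> Z"
proof -
  have m: "x \<in> M n g \<longleftrightarrow> x \<in> M' n g" if "x \<in> Z" "g \<in> carrier G" for x n g
    using eq[OF that(2), of n] that(1) by blast
  have im: "x \<in> \<phi> g ` M n g \<longleftrightarrow> x \<in> \<phi> g ` M' n g" if "x \<in> Z" "g \<in> carrier G" for x n g
    using act_image_Int[OF Z that(2) sub[OF that(2)] eq[OF that(2)], of n] that(1) by blast
  have "core M \<inter> Z = core M' \<inter> Z" unfolding core_def using m by auto
  moreover have "bad M \<inter> Z = bad M' \<inter> Z"
  proof -
    have "x \<in> bad M \<longleftrightarrow> x \<in> bad M'" if x: "x \<in> Z" for x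
      unfolding bad_iff by (simp only: m[OF x] im[OF x] cong: bex_cong)
    then show ?thesis by blast
  qed
  ultimately show ?thesis unfolding code_dom_def using sat_Int[OF Z] by blast
qed

lemma invariant_code_dom: "invariant (code_dom M)"
proof (rule invariantI)
  show \<Omega>: "x \<in> \<Omega>" if "x \<in> code_dom M" for x using that by (simp add: code_dom_def sat_def)
  show "y \<in> code_dom M" if "x \<in> code_dom M" "y \<in> orb x" for x y
    using that sat_orb[OF that(2) \<Omega>[OF that(1)]] by (simp add: code_dom_def)
qed

lemma invariant_disjointed:
  assumes "\<And>i::nat. invariant (C i)"
  shows "invariant (disjointed C j)"
proof (rule invariantI)
  show \<Omega>: "x \<in> \<Omega>" if "x \<in> disjointed C j" for x
    using that assms disjointed_subset[of C j] unfolding invariant_def by blast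
  show "y \<in> disjointed C j" if "x \<in> disjointed C j" "y \<in> orb x" for x y
    using that invariantD[OF assms that(2) \<Omega>[OF that(1)]] unfolding disjointed_def by simp
qed

lemma ia_disjointed:
  assumes "invariant_algebra L" "\<And>i::nat. C i \<in> L"
  shows "disjointed C j \<in> L"
  unfolding disjointed_def by (intro ia_Diff[OF assms(1)] ia_UN[OF assms(1)] assms(2)) simp

lemma Int_UN_disjointed:
  fixes P :: "nat \<Rightarrow> 'b set"
  shows "(\<Union>j. P j \<inter> disjointed C j) \<inter> disjointed C i = P i \<inter> disjointed C i"
proof -
  have "j = i" if "x \<in> disjointed C j" "x \<in> disjointed C i" for x j
    using disjoint_family_disjointed[of C] that unfolding disjoint_family_on_def by blast
  then show ?thesis by blast
qed

text \<open>The merged sets agree with the \<open>j\<close>-th triple on \<open>?D j\<close>, but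
  nothing puts \<open>?D j\<close> into the algebra they generate. Each system is therefore copied
  into that algebra with the same trace on \<open>?D j\<close>, and the \<open>code_dom\<close> of
  the copies, which the algebra does contain, cut the space afresh.\<close>

lemma codable_glue:
  assumes "negligible \<Omega>"
  obtains P Q F where "P \<in> sets X" "Q \<in> sets X" "F \<in> sets X" "codable (gen_algebra {P, Q, F}) \<Omega>"
proof -
  obtain P Q F Z where 0: "\<And>j::nat. P j \<in> sets X" "\<And>j. Q j \<in> sets X" "\<And>j. F j \<in> sets X"
    "\<And>j. codable (gen_algebra {P j, Q j, F j}) (Z j)" "\<Omega> \<subseteq> (\<Union>j. Z j)"
    using assms unfolding negligible_def by metis
  have "\<exists>M. \<forall>j. (\<forall>n. \<forall>g\<in>carrier G. M j n g \<in> gen_algebra {P j, Q j, F j}) \<and> Z j \<subseteq> code_dom (M j)"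
    by (rule choice) (use 0(4) in \<open>simp add: codable_def\<close>)
  then obtain M where M: "\<And>j n g. g \<in> carrier G \<Longrightarrow> M j n g \<in> gen_algebra {P j, Q j, F j}"
    "\<And>j. Z j \<subseteq> code_dom (M j)" by metis
  define C where "C j = code_dom (M j)" for j
  have CX: "C j \<in> sets X" for j
  proof -
    have "C j \<in> gen_algebra {P j, Q j, F j}" unfolding C_def
      by (rule code_dom_in(3)[OF gen3_ia[OF 0(1-3)] M(1)])
    then show ?thesis using gen_sets[of "{P j, Q j, F j}"] 0(1-3) by auto
  qed
  have Ci: "invariant (C j)" for j unfolding C_def by (rule invariant_code_dom)
  let ?D = "disjointed C"
  note Di = invariant_disjointed[OF Ci]
  have DX: "?D j \<in> sets X" for j by (rule ia_disjointed[OF invariant_algebra_sets CX])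
  have Dcov: "(\<Union>j. ?D j) = \<Omega>"
  proof
    show "(\<Union>j. ?D j) \<subseteq> \<Omega>" using DX sets.sets_into_space by blast
    have "\<Omega> \<subseteq> (\<Union>j. C j)" using 0(5) M(2) unfolding C_def by blast
    then show "\<Omega> \<subseteq> (\<Union>j. ?D j)" by (simp add: UN_disjointed_eq)
  qed
  define P' where "P' = (\<Union>j. P j \<inter> ?D j)"
  define Q' where "Q' = (\<Union>j. Q j \<inter> ?D j)"
  define F' where "F' = (\<Union>j. F j \<inter> ?D j)"
  have PQF: "P' \<in> sets X" "Q' \<in> sets X" "F' \<in> sets X"
    unfolding P'_def Q'_def F'_def using 0(1-3) DX by auto
  let ?L = "gen_algebra {P', Q', F'}"
  note L = gen3_ia[OF PQF]
  have "\<exists>A'\<in>?L. M j n g \<inter> ?D j = A' \<inter> ?D j" if g: "g \<in> carrier G" for j n g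
  proof (rule gen_trace[OF Di _ _ _ M(1)[OF g]])
    show "{P j, Q j, F j} \<subseteq> Pow \<Omega>" "{P', Q', F'} \<subseteq> Pow \<Omega>"
      using 0(1-3)[of j] PQF sets.sets_into_space by blast+
    show "\<exists>A'\<in>{P', Q', F'}. A \<inter> ?D j = A' \<inter> ?D j" if "A \<in> {P j, Q j, F j}" for A
      using that Int_UN_disjointed[of P C j] Int_UN_disjointed[of Q C j] Int_UN_disjointed[of F C j]
      unfolding P'_def Q'_def F'_def by auto
  qed
  then have *: "\<exists>A'. A' \<in> ?L \<and> M j n g \<inter> ?D j = A' \<inter> ?D j" if "g \<in> carrier G" for j n g
    using that by (simp add: Bex_def)
  \<comment> \<open>An arbitrary copy: its behaviour off \<open>?D j\<close> is uncontrolled, and it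
    may fail to code there.\<close>
  define N where "N j n g = (SOME A'. A' \<in> ?L \<and> M j n g \<inter> ?D j = A' \<inter> ?D j)" for j n g
  have N: "N j n g \<in> ?L" "M j n g \<inter> ?D j = N j n g \<inter> ?D j" if "g \<in> carrier G" for j n g
    using someI_ex[OF *[OF that]] unfolding N_def by simp_all
  have Msub: "M j n g \<subseteq> \<Omega>" if "g \<in> carrier G" for j n g
    using ia_sub[OF gen3_ia[OF 0(1-3)] M(1)[OF that]] .
  have Nsub: "N j n g \<subseteq> \<Omega>" if "g \<in> carrier G" for j n g
    using ia_sub[OF L N(1)[OF that]] .
  define E where "E j = code_dom (N j)" for j
  have EL: "E j \<in> ?L" for j unfolding E_def by (rule code_dom_in(3)[OF L N(1)])
  have Ei: "invariant (E j)" for j unfolding E_def by (rule invariant_code_dom)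
  \<comment> \<open>The copy codes at least on \<open>?D j\<close>, so the sets \<open>E j\<close>,
    which are definable from the merged triple, still cover the space.\<close>
  have DE: "?D j \<subseteq> E j" for j
  proof -
    have "code_dom (M j) \<inter> ?D j = code_dom (N j) \<inter> ?D j"
      by (rule code_dom_Int[OF Di Msub Nsub N(2)])
    then show ?thesis using disjointed_subset[of C j] unfolding C_def E_def by blast
  qed
  let ?W = "disjointed E"
  note Wi = invariant_disjointed[OF Ei]
  have Wcov: "\<Omega> \<subseteq> (\<Union>j. ?W j)" 
    unfolding UN_disjointed_eq[of E] by (rule order_trans[OF equalityD2[OF Dcov] UN_mono[OF subset_refl DE]])
  \<comment> \<open>On \<open>?W j\<close> the system \<open>N j\<close> is valid even where
    \<open>?W j\<close> differs from \<open>?D j\<close>, because \<open>?W j\<close> is contained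
    in \<open>code_dom (N j)\<close>.\<close>
  define K where "K n g = (\<Union>j. N j n g \<inter> ?W j)" for n g
  have KL: "K n g \<in> ?L" if "g \<in> carrier G" for n g
    unfolding K_def by (intro ia_UN[OF L] ia_Int[OF L] N(1) that ia_disjointed[OF L EL]) simp
  have "?W j \<subseteq> code_dom K" for j
  proof -
    have "code_dom K \<inter> ?W j = code_dom (N j) \<inter> ?W j"
    proof (rule code_dom_Int[OF Wi _ Nsub])
      show "K n g \<subseteq> \<Omega>" if "g \<in> carrier G" for n g using ia_sub[OF L KL[OF that]] .
      show "K n g \<inter> ?W j = N j n g \<inter> ?W j" for n g unfolding K_def by (rule Int_UN_disjointed)
    qed
    moreover have "?W j \<subseteq> code_dom (N j)" using disjointed_subset[of E j] unfolding E_def .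
    ultimately show ?thesis by blast
  qed
  then have "\<Omega> \<subseteq> code_dom K" using Wcov by blast
  then have "codable ?L \<Omega>" unfolding codable_def using KL by (intro exI[of _ K] conjI allI ballI)
  with PQF show thesis by (rule that)
qed

text \<open>The point \<open>x\<close> of the core has one marker \<open>g x\<close> for each \<open>n\<close>, and \<open>B\<close> contains
  the \<open>n\<close>-th marker iff \<open>x \<in> U n\<close>; thus \<open>B\<close> records the whole itinerary of \<open>x\<close>.\<close>

lemma codable_generates:
  assumes PQF: "P \<in> sets X" "Q \<in> sets X" "F \<in> sets X" and cod: "codable (gen_algebra {P, Q, F}) \<Omega>"
  obtains B where "B \<in> sets X" "sets X = gen_algebra {P, Q, F, B}"
proof -
  have sb: "standard_borel X" using space unfolding borel_G_space_def by simp
  obtain U :: "nat \<Rightarrow> 'a set" where U: "sets X = sigma_sets \<Omega> (range U)" "\<And>n. U n \<in> sets X"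
    by (rule standard_borel_countable_base[OF sb], rule that)
  obtain M where M: "\<And>n g. g \<in> carrier G \<Longrightarrow> M n g \<in> gen_algebra {P, Q, F}" and dom: "\<Omega> \<subseteq> code_dom M"
    using cod unfolding codable_def by metis
  note L3 = gen3_ia[OF PQF]
  have "gen_algebra {P, Q, F} \<subseteq> sets X" using PQF by (intro gen_sets) simp
  then have MX: "M n g \<in> sets X" if "g \<in> carrier G" for n g using M[OF that] by blast
  define B where "B = (\<Union>n. \<Union>g\<in>carrier G. \<phi> g ` (M n g \<inter> U n))"
  have BX: "B \<in> sets X"
    unfolding B_def
    by (intro ia_UN[OF invariant_algebra_sets] act_measurable sets.Int MX U(2) cnt countableI_type)
  let ?S = "{P, Q, F, B}" let ?L = "gen_algebra ?S"
  have sub: "P \<subseteq> \<Omega>" "Q \<subseteq> \<Omega>" "F \<subseteq> \<Omega>" "B \<subseteq> \<Omega>" using PQF BX sets.sets_into_space by auto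
  have L: "invariant_algebra ?L" using sub by (intro gen_invariant_algebra) simp
  have BL: "B \<in> ?L" using sub by (intro gen_basic) simp_all
  have "{P, Q, F} \<subseteq> ?L" using sub gen_basic[of _ ?S] by simp
  then have MgL: "M n g \<in> ?L" if "g \<in> carrier G" for n g using gen_least[OF L] M[OF that] by blast
  have Msub: "M n g \<subseteq> \<Omega>" if "g \<in> carrier G" for n g using ia_sub[OF L MgL[OF that]] .
  have coreL: "core M \<in> ?L" by (rule code_dom_in(1)[OF L MgL])
  have "bad M \<subseteq> \<Omega>" using ia_sub[OF L code_dom_in(2)[OF L MgL]] .
  moreover have "x \<notin> bad M" if "x \<in> \<Omega>" for x
    using dom that orb_refl unfolding code_dom_def sat_def by blast
  ultimately have bad_empty: "bad M = {}" by blast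
  have inj: "(n, g) = (m, h)" if "g \<in> carrier G" "h \<in> carrier G" "y \<in> \<phi> g ` M n g" "y \<in> \<phi> h ` M m h" for n m g h y
  proof (rule ccontr)
    assume "(n, g) \<noteq> (m, h)"
    then have "y \<in> bad M" unfolding bad_def using that by (intro UnI2 UN_I[of "(n, g, m, h)"]) auto
    then show False using bad_empty by simp
  qed
  \<comment> \<open>Decoding: markers of different maps or different points never coincide, so the
    \<open>n\<close>-th marker of \<open>x\<close> can enter \<open>B\<close> only on account of
    \<open>x \<in> U n\<close>.\<close>
  have dec: "U n \<inter> core M = core M \<inter> (\<Union>g\<in>carrier G. M n g \<inter> \<phi> (inv g) ` B)" for n
  proof (rule Set.set_eqI)
    fix x
    have "x \<in> U n \<longleftrightarrow> x \<in> (\<Union>g\<in>carrier G. M n g \<inter> \<phi> (inv g) ` B)" if x: "x \<in> core M"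
    proof
      assume xU: "x \<in> U n"
      obtain g where g: "g \<in> carrier G" "x \<in> M n g" using x unfolding core_def by blast
      then have "\<phi> g x \<in> B" unfolding B_def using xU by blast
      then have "x \<in> \<phi> (inv g) ` B" using mem_act_image_inv[OF g(1) sub(4)] Msub[OF g(1)] g(2) by blast
      then show "x \<in> (\<Union>g\<in>carrier G. M n g \<inter> \<phi> (inv g) ` B)" using g by blast
    next
      assume "x \<in> (\<Union>g\<in>carrier G. M n g \<inter> \<phi> (inv g) ` B)"
      then obtain g where g: "g \<in> carrier G" "x \<in> M n g" "\<phi> g x \<in> B"
        using mem_act_image_inv[OF _ sub(4)] by blast
      then obtain m h y where y: "h \<in> carrier G" "y \<in> M m h" "y \<in> U m" "\<phi> g x = \<phi> h y"
        unfolding B_def by blast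
      have "(n, g) = (m, h)"
        by (rule inj[OF g(1) y(1) imageI[OF g(2)]]) (use y(2,4) in simp)
      then have nm: "n = m" "g = h" by auto
      then have "x = y" using y(4) act.inj_prop[OF g(1)] Msub[OF g(1)] g(2) y(2) by (meson inj_onD subsetD)
      then show "x \<in> U n" using y(3) nm by simp
    qed
    then show "x \<in> U n \<inter> core M \<longleftrightarrow> x \<in> core M \<inter> (\<Union>g\<in>carrier G. M n g \<inter> \<phi> (inv g) ` B)" by blast
  qed
  have Ucore: "U n \<inter> core M \<in> ?L" for n
    unfolding dec by (intro ia_Int[OF L] ia_UN[OF L cnt] coreL MgL ia_act[OF L] inv_closed BL)
  have Acore: "A \<inter> core M \<in> ?L" if "A \<in> sigma_sets \<Omega> (range U)" for A
    using that
  proof (induction rule: sigma_sets.induct)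
    case (Basic a) then show ?case using Ucore by auto
  next
    case Empty show ?case using ia_empty[OF L] by simp
  next
    case (Compl a)
    have "(\<Omega> - a) \<inter> core M = core M - a \<inter> core M" using ia_sub[OF L coreL] by blast
    then show ?case using ia_Diff[OF L coreL Compl.IH] by simp
  next
    case (Union a)
    have "(\<Union>i. a i) \<inter> core M = (\<Union>i. a i \<inter> core M)" by blast
    then show ?case using ia_UN[OF L, of UNIV "\<lambda>i. a i \<inter> core M"] Union.IH by simp
  qed
  have "A \<in> ?L" if A: "A \<in> sets X" for A
  proof -
    have As: "A \<subseteq> \<Omega>" using A sets.sets_into_space by blast
    \<comment> \<open>Every orbit meets the core, so each point of \<open>A\<close> can be moved
      into the core, recognised there and moved back.\<close>
    have "A = (\<Union>g\<in>carrier G. \<phi> (inv g) ` (\<phi> g ` A \<inter> core M))"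
    proof
      show "A \<subseteq> (\<Union>g\<in>carrier G. \<phi> (inv g) ` (\<phi> g ` A \<inter> core M))"
      proof
        fix x assume x: "x \<in> A"
        then have x\<Omega>: "x \<in> \<Omega>" using As by blast
        then have "x \<in> sat (core M)" using dom unfolding code_dom_def by blast
        then obtain y where y: "y \<in> orb x" "y \<in> core M" unfolding sat_def by blast
        obtain g where g: "g \<in> carrier G" "y = \<phi> g x" using y(1) by (rule orbE)
        have "x = \<phi> (inv g) (\<phi> g x)" using g x\<Omega> by simp
        then have "x \<in> \<phi> (inv g) ` (\<phi> g ` A \<inter> core M)" using x y(2) g(2) by blast
        then show "x \<in> (\<Union>g\<in>carrier G. \<phi> (inv g) ` (\<phi> g ` A \<inter> core M))" using g(1) by blast
      qed
      show "(\<Union>g\<in>carrier G. \<phi> (inv g) ` (\<phi> g ` A \<inter> core M)) \<subseteq> A"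
      proof
        fix y assume "y \<in> (\<Union>g\<in>carrier G. \<phi> (inv g) ` (\<phi> g ` A \<inter> core M))"
        then obtain g x where "g \<in> carrier G" "x \<in> A" "y = \<phi> (inv g) (\<phi> g x)" by blast
        then show "y \<in> A" using As by auto
      qed
    qed
    moreover have "\<phi> (inv g) ` (\<phi> g ` A \<inter> core M) \<in> ?L" if "g \<in> carrier G" for g
      using Acore[OF act_measurable[OF that A, unfolded U(1)]] by (rule ia_act[OF L inv_closed[OF that]])
    then have "(\<Union>g\<in>carrier G. \<phi> (inv g) ` (\<phi> g ` A \<inter> core M)) \<in> ?L" by (rule ia_UN[OF L cnt])
    ultimately show ?thesis by simp
  qed
  moreover have "?L \<subseteq> sets X" using PQF BX by (intro gen_sets) simp
  ultimately have "sets X = ?L" by blast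
  with BX show thesis by (rule that)
qed

text \<open>The pieces are the atoms of the finite algebra generated by the family, one for each set
  of indices; every \<open>C i\<close> is a union of atoms.\<close>

lemma generator_of_family:
  assumes C: "\<And>i::nat. i < k \<Longrightarrow> C i \<in> sets X" and gen: "sets X = gen_algebra (C ` {..<k})"
  shows "\<exists>P. generator G X \<phi> (2 ^ k) P"
proof -
  have "finite (Pow {..<k})" "card (Pow {..<k}) = 2 ^ k" by (simp_all add: card_Pow)
  then obtain e where e: "bij_betw e {..<2 ^ k :: nat} (Pow {..<k})"
    using ex_bij_betw_nat_finite[of "Pow {..<k}"] by (auto simp: atLeast0LessThan)
  define sig where "sig x = {i\<in>{..<k}. x \<in> C i}" for x
  define P where "P n = {x \<in> \<Omega>. sig x = e n}" for n
  have PX: "P n \<in> sets X" for n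
  proof -
    have "P n = {x \<in> \<Omega>. \<forall>i\<in>{..<k}. x \<in> C i \<longleftrightarrow> i \<in> e n} \<inter> (if e n \<subseteq> {..<k} then \<Omega> else {})"
      unfolding P_def sig_def by (auto split: if_splits)
    moreover have "{x \<in> \<Omega>. x \<in> C i \<longleftrightarrow> i \<in> e n} \<in> sets X" if "i < k" for i
    proof (cases "i \<in> e n")
      case True
      have "{x \<in> \<Omega>. x \<in> C i \<longleftrightarrow> i \<in> e n} = C i" using True sets.sets_into_space[OF C[OF that]] by blast
      then show ?thesis using C[OF that] by simp
    next
      case False
      have "{x \<in> \<Omega>. x \<in> C i \<longleftrightarrow> i \<in> e n} = \<Omega> - C i" using False by blast
      then show ?thesis using C[OF that] by simp
    qed
    then have "{x \<in> \<Omega>. \<forall>i\<in>{..<k}. x \<in> C i \<longleftrightarrow> i \<in> e n} \<in> sets X"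
      by (intro sets.sets_Collect_finite_All) auto
    ultimately show ?thesis by simp
  qed
  have "borel_partition X {..<2 ^ k} P \<Omega>"
    unfolding borel_partition_def
  proof (intro conjI ballI)
    show "disjoint_family_on P {..<2 ^ k}"
      unfolding disjoint_family_on_def P_def using bij_betw_imp_inj_on[OF e] by (auto dest: inj_onD)
    show "(\<Union>n\<in>{..<2 ^ k}. P n) = \<Omega>"
    proof
      show "\<Omega> \<subseteq> (\<Union>n\<in>{..<2 ^ k}. P n)"
      proof
        fix x assume "x \<in> \<Omega>"
        moreover have "sig x \<in> e ` {..<2 ^ k}" using bij_betw_imp_surj_on[OF e] unfolding sig_def by auto
        ultimately show "x \<in> (\<Union>n\<in>{..<2 ^ k}. P n)" unfolding P_def by auto
      qed
    qed (auto simp: P_def)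
  qed (rule PX)
  moreover have "gen_algebra (P ` {..<2 ^ k}) = sets X"
  proof
    show "gen_algebra (P ` {..<2 ^ k}) \<subseteq> sets X" using PX by (intro gen_sets) auto
    have Psub: "P n \<subseteq> \<Omega>" for n unfolding P_def by blast
    have L: "invariant_algebra (gen_algebra (P ` {..<2 ^ k}))"
      using Psub by (intro gen_invariant_algebra) auto
    have "C i \<in> gen_algebra (P ` {..<2 ^ k})" if i: "i < k" for i
    proof -
      have "C i = (\<Union>n\<in>{n\<in>{..<2 ^ k}. i \<in> e n}. P n)"
      proof
        show "C i \<subseteq> (\<Union>n\<in>{n\<in>{..<2 ^ k}. i \<in> e n}. P n)"
        proof
          fix x assume x: "x \<in> C i"
          obtain n where n: "n < 2 ^ k" "sig x = e n"
            using bij_betw_imp_surj_on[OF e] unfolding sig_def by blast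
          have "x \<in> P n" unfolding P_def using n x sets.sets_into_space[OF C[OF i]] by blast
          moreover have "i \<in> e n" using n(2) x i unfolding sig_def by blast
          ultimately show "x \<in> (\<Union>n\<in>{n\<in>{..<2 ^ k}. i \<in> e n}. P n)" using n(1) by blast
        qed
      qed (auto simp: P_def sig_def)
      also have "\<dots> \<in> gen_algebra (P ` {..<2 ^ k})"
        by (rule ia_UN[OF L]) (use Psub in \<open>auto intro!: gen_basic\<close>)
      finally show ?thesis .
    qed
    then show "sets X \<subseteq> gen_algebra (P ` {..<2 ^ k})" unfolding gen by (intro gen_least[OF L]) auto
  qed
  moreover have "{\<phi> g ` A | g A. g \<in> carrier G \<and> A \<in> P ` {..<2 ^ k}} = {\<phi> g ` P n | g n. g \<in> carrier G \<and> n < 2 ^ k}"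
    by blast
  ultimately show ?thesis unfolding generator_def gen_algebra_def by (intro exI[of _ P]) simp
qed

lemma generator_of_negligible:
  assumes "negligible \<Omega>"
  shows "\<exists>P. generator G X \<phi> 32 P"
proof -
  obtain P Q F where PQF: "P \<in> sets X" "Q \<in> sets X" "F \<in> sets X" "codable (gen_algebra {P, Q, F}) \<Omega>"
    using codable_glue[OF assms] .
  then obtain B where B: "B \<in> sets X" "sets X = gen_algebra {P, Q, F, B}" by (rule codable_generates)
  \<comment> \<open>Repeating \<open>B\<close> brings the four sets to five, so that the number of
    patterns is exactly \<open>2 ^ 5\<close>; the surplus pieces are empty.\<close>
  let ?C = "(!) [P, Q, F, B, B]"
  have "?C ` {..<5} = {P, Q, F, B}" by (auto simp: lessThan_nat_numeral lessThan_Suc)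
  moreover have "?C i \<in> sets X" if "i < 5" for i
  proof -
    have "?C i \<in> set [P, Q, F, B, B]" using that by (intro nth_mem) simp
    then show ?thesis using PQF B by auto
  qed
  ultimately have "\<exists>P. generator G X \<phi> (2 ^ 5) P" using B(2) by (intro generator_of_family[of 5 ?C]) simp_all
  then show ?thesis by simp
qed

section \<open>Locally finitely traveling sections\<close>

lemma level_empty:
  assumes "x \<in> sat F"
  shows "level {} F x = 0"
proof -
  obtain y where "y \<in> orb x" "y \<in> F" using assms unfolding sat_def by blast
  then have "x \<notin> packed {} F (Suc 0)" unfolding packed_def using tile_sub[of "{}" F 0] by auto
  then show ?thesis unfolding level_def by (intro Least_equality) auto
qed

lemma level_UN_le:
  assumes Y: "\<And>k::nat. Y k \<in> sets X" and F: "F \<in> sets X"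
  shows "generic (\<lambda>x. x \<in> sat F \<longrightarrow> (\<forall>b. level (\<Union>k<b. Y k) F x \<le> (\<Sum>k<b. level (Y k) F x) + 2 * b))"
proof -
  have U: "(\<Union>k<b. Y k) \<in> sets X" for b using Y by auto
  have "generic (\<lambda>x. \<forall>b. x \<in> sat F \<longrightarrow>
      level ((\<Union>k<b. Y k) \<union> Y b) F x \<le> level (\<Union>k<b. Y k) F x + level (Y b) F x + 2)"
    by (intro generic_all level_union_le U Y F)
  then show ?thesis
  proof (rule generic_mono, intro impI allI)
    fix x b
    assume x: "x \<in> sat F" and *: "\<forall>b. x \<in> sat F \<longrightarrow>
      level ((\<Union>k<b. Y k) \<union> Y b) F x \<le> level (\<Union>k<b. Y k) F x + level (Y b) F x + 2"
    show "level (\<Union>k<b. Y k) F x \<le> (\<Sum>k<b. level (Y k) F x) + 2 * b"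
    proof (induction b)
      case 0 then show ?case using level_empty[OF x] by simp
    next
      case (Suc b)
      have "(\<Union>k<Suc b. Y k) = (\<Union>k<b. Y k) \<union> Y b" by (auto simp: lessThan_Suc)
      then show ?case using *[rule_format, OF x, of b] Suc by simp
    qed
  qed
qed

lemma level_UN_ge:
  assumes Y: "\<And>k::nat. Y k \<in> sets X" and disj: "disjoint_family Y" and F: "F \<in> sets X"
  shows "generic (\<lambda>x. x \<in> sat F \<longrightarrow> (\<forall>b. (\<Sum>k<b. level (Y k) F x) \<le> level (\<Union>k<b. Y k) F x + b))"
proof -
  have U: "(\<Union>k<b. Y k) \<in> sets X" for b using Y by auto
  have D: "(\<Union>k<b. Y k) \<inter> Y b = {}" for b
  proof -
    have "Y k \<inter> Y b = {}" if "k < b" for k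
      using disjoint_family_onD[OF disj UNIV_I UNIV_I, of k b] that by simp
    then show ?thesis by blast
  qed
  have "generic (\<lambda>x. \<forall>b. x \<in> sat F \<longrightarrow>
      level (\<Union>k<b. Y k) F x + level (Y b) F x \<le> level ((\<Union>k<b. Y k) \<union> Y b) F x + 1)"
    by (intro generic_all level_union_ge U Y F D)
  then show ?thesis
  proof (rule generic_mono, intro impI allI)
    fix x b
    assume x: "x \<in> sat F" and *: "\<forall>b. x \<in> sat F \<longrightarrow>
      level (\<Union>k<b. Y k) F x + level (Y b) F x \<le> level ((\<Union>k<b. Y k) \<union> Y b) F x + 1"
    show "(\<Sum>k<b. level (Y k) F x) \<le> level (\<Union>k<b. Y k) F x + b"
    proof (induction b)
      case (Suc b)
      have "(\<Union>k<Suc b. Y k) = (\<Union>k<b. Y k) \<union> Y b" by (auto simp: lessThan_Suc)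
      then show ?case using *[rule_format, OF x, of b] Suc by simp
    qed simp
  qed
qed

lemma lfin_pieces:
  assumes "lfin_equidecomposable G X \<phi> A B"
  obtains g P Q where "\<And>k::nat. g k \<in> carrier G" "\<And>k. P k \<in> sets X" "\<And>k. Q k \<in> sets X"
    "disjoint_family Q" "(\<Union>k. P k) = A" "(\<Union>k. Q k) = B" "\<And>k. \<phi> (g k) ` P k = Q k"
    "\<And>x. x \<in> A \<Longrightarrow> finite {k. P k \<inter> orb x \<noteq> {}}"
proof -
  obtain N g P Q where g: "\<forall>n. enat n < N \<longrightarrow> g n \<in> carrier G"
    and P: "borel_partition X {n. enat n < N} P A" and Q: "borel_partition X {n. enat n < N} Q B"
    and gPQ: "\<forall>n. enat n < N \<longrightarrow> \<phi> (g n) ` P n = Q n"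
    and fin: "\<forall>x\<in>A. finite {n. enat n < N \<and> P n \<inter> orb x \<noteq> {}}"
    using assms unfolding lfin_equidecomposable_def by (elim conjE exE) (rule that)
  let ?c = "\<lambda>n. enat n < N"
  show thesis
  \<comment> \<open>Pieces with index beyond \<open>N\<close> become empty, with the identity as
    their group element, so all families are indexed by every natural number.\<close>
  proof (rule that[of "\<lambda>n. if ?c n then g n else \<one>" "\<lambda>n. if ?c n then P n else {}" "\<lambda>n. if ?c n then Q n else {}"])
    show "disjoint_family (\<lambda>n. if ?c n then Q n else {})"
      using Q unfolding borel_partition_def disjoint_family_on_def by auto
    show "(\<Union>n. if ?c n then P n else {}) = A" "(\<Union>n. if ?c n then Q n else {}) = B"
      using P Q unfolding borel_partition_def by (auto split: if_splits)
    fix x assume "x \<in> A"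
    then show "finite {k. (if ?c k then P k else {}) \<inter> orb x \<noteq> {}}"
      by (rule rev_finite_subset[OF fin[rule_format]]) (auto split: if_splits)
  qed (use g P Q gPQ in \<open>auto simp: borel_partition_def\<close>)
qed

text \<open>If the first \<open>b\<close> pieces exhaust the source on the orbit, levels are
  compared piece by piece. Splitting the source costs \<open>2 * b\<close>, shifting the pieces
  \<open>b\<close>, and reassembling the target \<open>b\<close>; passing between the finite and the
  full unions costs 1 on each side.\<close>

lemma level_le_equidecomposed:
  assumes g: "\<And>k::nat. g k \<in> carrier G" and P: "\<And>k. P k \<in> sets X" and Q: "\<And>k. Q k \<in> sets X"
    and disj: "disjoint_family Q" and gPQ: "\<And>k. \<phi> (g k) ` P k = Q k" and F: "F \<in> sets X"
  shows "generic (\<lambda>x. x \<in> sat F \<longrightarrow>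
    (\<forall>b. (\<Union>k. P k) \<inter> orb x \<subseteq> (\<Union>k<b. P k) \<longrightarrow> level (\<Union>k. P k) F x \<le> level (\<Union>k. Q k) F x + 4 * b + 2))"
proof -
  have PQ: "\<phi> (inv (g k)) ` Q k = P k" for k
  proof -
    have "\<phi> (inv (g k)) (\<phi> (g k) x) = x" if "x \<in> P k" for x
      using act_inv[OF g] subsetD[OF sets.sets_into_space[OF P] that] by blast
    then have "\<phi> (inv (g k)) ` \<phi> (g k) ` P k = (\<lambda>x. x) ` P k"
      unfolding image_image by (rule image_cong[OF refl])
    then show ?thesis using gPQ by simp
  qed
  have shift: "generic (\<lambda>x. \<forall>k. x \<in> sat F \<longrightarrow> level (P k) F x \<le> level (Q k) F x + 1)"
    using level_shift[OF Q F inv_closed[OF g]] PQ by (intro generic_all) metis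
  have monoP: "generic (\<lambda>x. \<forall>b. x \<in> sat F \<longrightarrow> (\<Union>k. P k) \<inter> orb x \<subseteq> (\<Union>k<b. P k) \<longrightarrow>
      level (\<Union>k. P k) F x \<le> level (\<Union>k<b. P k) F x + 1)"
    using P by (intro generic_all level_mono F) auto
  have monoQ: "generic (\<lambda>x. \<forall>b. x \<in> sat F \<longrightarrow> (\<Union>k<b. Q k) \<inter> orb x \<subseteq> (\<Union>k. Q k) \<longrightarrow>
      level (\<Union>k<b. Q k) F x \<le> level (\<Union>k. Q k) F x + 1)"
    using Q by (intro generic_all level_mono F) auto
  note all = generic_conj[OF shift generic_conj[OF monoP generic_conj[OF monoQ generic_conj[OF level_UN_le[OF P F] level_UN_ge[OF Q disj F]]]]]
  then show ?thesis
  proof (rule generic_mono, intro impI allI)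
    fix x b
    assume x: "x \<in> sat F" and sub: "(\<Union>k. P k) \<inter> orb x \<subseteq> (\<Union>k<b. P k)"
      and *: "(\<forall>k. x \<in> sat F \<longrightarrow> level (P k) F x \<le> level (Q k) F x + 1) \<and>
        (\<forall>b. x \<in> sat F \<longrightarrow> (\<Union>k. P k) \<inter> orb x \<subseteq> (\<Union>k<b. P k) \<longrightarrow>
          level (\<Union>k. P k) F x \<le> level (\<Union>k<b. P k) F x + 1) \<and>
        (\<forall>b. x \<in> sat F \<longrightarrow> (\<Union>k<b. Q k) \<inter> orb x \<subseteq> (\<Union>k. Q k) \<longrightarrow>
          level (\<Union>k<b. Q k) F x \<le> level (\<Union>k. Q k) F x + 1) \<and>
        (x \<in> sat F \<longrightarrow> (\<forall>b. level (\<Union>k<b. P k) F x \<le> (\<Sum>k<b. level (P k) F x) + 2 * b)) \<and>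
        (x \<in> sat F \<longrightarrow> (\<forall>b. (\<Sum>k<b. level (Q k) F x) \<le> level (\<Union>k<b. Q k) F x + b))"
    have "(\<Sum>k<b. level (P k) F x) \<le> (\<Sum>k<b. level (Q k) F x + 1)"
      by (intro sum_mono) (use * x in blast)
    also have "\<dots> = (\<Sum>k<b. level (Q k) F x) + b" by (simp only: sum.distrib) simp
    finally have 1: "(\<Sum>k<b. level (P k) F x) \<le> (\<Sum>k<b. level (Q k) F x) + b" .
    have "(\<Union>k<b. Q k) \<inter> orb x \<subseteq> (\<Union>k. Q k)" by blast
    then have 2: "level (\<Union>k<b. Q k) F x \<le> level (\<Union>k. Q k) F x + 1" using * x by blast
    have 3: "level (\<Union>k. P k) F x \<le> level (\<Union>k<b. P k) F x + 1" using * x sub by blast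
    have 4: "level (\<Union>k<b. P k) F x \<le> (\<Sum>k<b. level (P k) F x) + 2 * b" using * x by blast
    have 5: "(\<Sum>k<b. level (Q k) F x) \<le> level (\<Union>k<b. Q k) F x + b" using * x by blast
    show "level (\<Union>k. P k) F x \<le> level (\<Union>k. Q k) F x + 4 * b + 2" using 1 2 3 4 5 by linarith
  qed
qed

text \<open>If all but boundedly much of \<open>level A\<close> reappears in each of the disjoint sets \<open>S n\<close>, then
  taking more of them than copies of \<open>A\<close> needed to cover the space bounds \<open>level A F\<close> independently of \<open>F\<close>.\<close>

lemma level_bounded:
  assumes A: "A \<in> sets X" and cs: "\<And>x. x \<in> \<Omega> \<Longrightarrow> x \<in> sat A"
    and S: "\<And>n::nat. S n \<in> sets X" "disjoint_family S"
    and eq: "\<And>n F. F \<in> sets X \<Longrightarrow> generic (\<lambda>x. x \<in> sat F \<longrightarrow> level A F x \<le> level (S n) F x + d n x)"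
    and F: "F \<in> sets X"
  shows "generic (\<lambda>x. x \<in> sat F \<longrightarrow>
    level A F x \<le> 2 * level \<Omega> A x + 4 + (\<Sum>n<level \<Omega> A x + 2. d n x))"
proof -
  have "generic (\<lambda>x. \<forall>n. x \<in> sat F \<longrightarrow> level A F x \<le> level (S n) F x + d n x)"
    by (intro generic_all eq F)
  moreover have "generic (\<lambda>x. \<forall>m. x \<in> sat F \<longrightarrow> (\<Union>n<m. S n) \<inter> orb x \<subseteq> \<Omega> \<longrightarrow>
      level (\<Union>n<m. S n) F x \<le> level \<Omega> F x + 1)"
    using S(1) by (intro generic_all level_mono F) auto
  ultimately have "generic (\<lambda>x. (\<forall>n. x \<in> sat F \<longrightarrow> level A F x \<le> level (S n) F x + d n x) \<and>
    (\<forall>m. x \<in> sat F \<longrightarrow> (\<Union>n<m. S n) \<inter> orb x \<subseteq> \<Omega> \<longrightarrow> level (\<Union>n<m. S n) F x \<le> level \<Omega> F x + 1) \<and>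
    (x \<in> sat F \<longrightarrow> (\<forall>m. (\<Sum>n<m. level (S n) F x) \<le> level (\<Union>n<m. S n) F x + m)) \<and>
    (x \<in> sat F \<longrightarrow> x \<in> sat A \<longrightarrow> level \<Omega> F x \<le> (level \<Omega> A x + 1) * (level A F x + 1)))"
    by (intro generic_conj level_UN_ge S F level_prod A sets.top)
  then show ?thesis
  proof (rule generic_mono, intro impI)
    fix x
    assume x\<Omega>: "x \<in> \<Omega>" and x: "x \<in> sat F"
      and *: "(\<forall>n. x \<in> sat F \<longrightarrow> level A F x \<le> level (S n) F x + d n x) \<and>
    (\<forall>m. x \<in> sat F \<longrightarrow> (\<Union>n<m. S n) \<inter> orb x \<subseteq> \<Omega> \<longrightarrow> level (\<Union>n<m. S n) F x \<le> level \<Omega> F x + 1) \<and>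
    (x \<in> sat F \<longrightarrow> (\<forall>m. (\<Sum>n<m. level (S n) F x) \<le> level (\<Union>n<m. S n) F x + m)) \<and>
    (x \<in> sat F \<longrightarrow> x \<in> sat A \<longrightarrow> level \<Omega> F x \<le> (level \<Omega> A x + 1) * (level A F x + 1))"
    \<comment> \<open>The space is covered by \<open>?c + 1\<close> copies of \<open>A\<close>.
      Taking one more of the sets \<open>S n\<close> leaves a single \<open>level A F x\<close>
      uncancelled, and the remaining terms bound it.\<close>
    let ?c = "level \<Omega> A x" let ?m = "?c + 2" let ?D = "\<Sum>n<?m. d n x"
    have "?m * level A F x = (\<Sum>n<?m. level A F x)" by simp
    also have "\<dots> \<le> (\<Sum>n<?m. level (S n) F x + d n x)" by (intro sum_mono) (use * x in blast)
    also have "\<dots> = (\<Sum>n<?m. level (S n) F x) + ?D" by (rule sum.distrib)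
    finally have 1: "?m * level A F x \<le> (\<Sum>n<?m. level (S n) F x) + ?D" .
    have 2: "(\<Sum>n<?m. level (S n) F x) \<le> level (\<Union>n<?m. S n) F x + ?m" using * x by blast
    have "(\<Union>n<?m. S n) \<inter> orb x \<subseteq> \<Omega>" using orb_sub x\<Omega> by blast
    then have 3: "level (\<Union>n<?m. S n) F x \<le> level \<Omega> F x + 1" using * x by blast
    have 4: "level \<Omega> F x \<le> (?c + 1) * (level A F x + 1)" using * x cs[OF x\<Omega>] by blast
    have "?m * level A F x \<le> (?c + 1) * (level A F x + 1) + 1 + ?m + ?D" using 1 2 3 4 by linarith
    moreover have "?m * level A F x = (?c + 1) * level A F x + level A F x" by (simp add: algebra_simps)
    moreover have "(?c + 1) * (level A F x + 1) = (?c + 1) * level A F x + (?c + 1)" by (simp add: algebra_simps)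
    ultimately have "(?c + 1) * level A F x + level A F x \<le> (?c + 1) * level A F x + (?c + 1) + 1 + ?m + ?D"
      by (simp only:)
    then show "level A F x \<le> 2 * ?c + 4 + ?D" by linarith
  qed
qed

section \<open>Small sets with many disjoint translates inside the section\<close>

lemma infinite_section:
  assumes x: "x \<in> \<Omega>" and A: "A \<in> sets X" and m: "x \<notin> packed \<Omega> A m" and inf: "infinite (orb x)"
  shows "infinite (A \<inter> orb x)"
proof
  assume fin: "finite (A \<inter> orb x)"
  note L = invariant_algebra_sets
  \<comment> \<open>Only cardinality matters here, so the algebra can be all of
    \<open>sets X\<close>: the orbit is covered by finitely many injective images of parts of
    \<open>A \<inter> orb x\<close>.\<close>
  have "covers (sets X) A \<Omega> (orb x) m"
    by (rule covers_not_packed[OF L A sets.top]) (use m packed_orb[OF _ x] in blast)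
  then obtain \<nu> where \<nu>: "\<And>j. j < m \<Longrightarrow> pinj (sets X) (\<nu> j) \<and> Domain (\<nu> j) \<subseteq> A"
    "\<Omega> \<inter> orb x \<subseteq> (\<Union>j<m. Range (\<nu> j))" unfolding covers_def by metis
  have "orb x \<subseteq> (\<Union>j<m. \<nu> j `` (A \<inter> orb x))"
  proof
    fix y assume y: "y \<in> orb x"
    then have y\<Omega>: "y \<in> \<Omega>" using orb_sub x by blast
    then obtain j w where j: "j < m" "(w, y) \<in> \<nu> j" using \<nu>(2) y by blast
    have d: "drel (sets X) (\<nu> j)" using \<nu>(1)[OF j(1)] pinj_drel by blast
    have "w \<in> orb w" using drel_dom[OF L d j(2)] by simp
    also have "orb w = orb y" using drel_orb'[OF L d j(2)] by simp
    also have "\<dots> = orb x" using orb_eq[OF y x] .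
    finally show "y \<in> (\<Union>j<m. \<nu> j `` (A \<inter> orb x))" using j \<nu>(1)[OF j(1)] by blast
  qed
  moreover have "finite (\<nu> j `` (A \<inter> orb x))" if "j < m" for j
  proof -
    have sv: "single_valued (\<nu> j)" using \<nu>(1)[OF that] unfolding pinj_def by simp
    have "\<nu> j `` (A \<inter> orb x) \<subseteq> (\<lambda>a. THE b. (a, b) \<in> \<nu> j) ` (A \<inter> orb x)"
    proof
      fix b assume "b \<in> \<nu> j `` (A \<inter> orb x)"
      then obtain a where a: "a \<in> A \<inter> orb x" "(a, b) \<in> \<nu> j" by blast
      then have "(THE b. (a, b) \<in> \<nu> j) = b" using sv by (auto dest: single_valuedD)
      then show "b \<in> (\<lambda>a. THE b. (a, b) \<in> \<nu> j) ` (A \<inter> orb x)" using a(1) by blast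
    qed
    then show ?thesis using fin finite_surj by blast
  qed
  ultimately have "finite (orb x)" by (meson finite_UN_I finite_lessThan finite_subset lessThan_iff)
  then show False using inf by simp
qed

text \<open>The points \<open>g x\<close>, \<open>g\<close> in the list \<open>w\<close>, lie in \<open>A\<close> and have prescribed membership pattern in \<open>U\<^sub>0, \<dots>, U\<^sub>m\<^sub>-\<^sub>1\<close>.
  Group elements are given by their index so that there are only countably many such sets.\<close>

definition cylinder :: "(nat \<Rightarrow> 'a set) \<Rightarrow> 'a set \<Rightarrow> (nat \<times> nat list) list \<Rightarrow> nat \<Rightarrow> 'a set" where
  "cylinder U A w m = {z \<in> \<Omega>. \<forall>(i, D)\<in>set w. \<phi> (enum i) z \<in> A \<and> (\<forall>n<m. \<phi> (enum i) z \<in> U n \<longleftrightarrow> n \<in> set D)}"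

lemma cylinder_sets:
  assumes U: "\<And>n. U n \<in> sets X" and A: "A \<in> sets X"
  shows "cylinder U A w m \<in> sets X"
proof -
  have pre: "{z \<in> \<Omega>. \<phi> g z \<in> B} \<in> sets X" if g: "g \<in> carrier G" and B: "B \<in> sets X" for g B
  proof -
    have "{z \<in> \<Omega>. \<phi> g z \<in> B} = \<phi> (inv g) ` B"
      using mem_act_image_inv[OF g sets.sets_into_space[OF B]] by blast
    then show ?thesis using act_measurable[OF inv_closed[OF g] B] by simp
  qed
  have eq: "{z \<in> \<Omega>. \<phi> g z \<in> U n \<longleftrightarrow> c} \<in> sets X" if "g \<in> carrier G" for g n c
  proof (cases c)
    case True then show ?thesis using pre[OF that U] by simp
  next
    case False
    then have "{z \<in> \<Omega>. \<phi> g z \<in> U n \<longleftrightarrow> c} = \<Omega> - {z \<in> \<Omega>. \<phi> g z \<in> U n}" by blast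
    then show ?thesis using pre[OF that U] by simp
  qed
  have "{z \<in> \<Omega>. \<forall>p\<in>set w. \<phi> (enum (fst p)) z \<in> A \<and>
      (\<forall>n\<in>{..<m}. \<phi> (enum (fst p)) z \<in> U n \<longleftrightarrow> n \<in> set (snd p))} \<in> sets X"
    by (intro sets.sets_Collect_finite_All sets.sets_Collect_conj pre eq A enum_in) auto
  then show ?thesis unfolding cylinder_def by (simp add: split_beta Ball_def)
qed

text \<open>Two translates are disjoint because the prescribed patterns of their points differ at
  some coordinate below \<open>m\<close>.\<close>

lemma level_cylinder:
  assumes U: "\<And>n. U n \<in> sets X" and A: "A \<in> sets X"
    and sep: "\<And>i j. i < length w \<Longrightarrow> j < length w \<Longrightarrow> i \<noteq> j \<Longrightarrow>
      \<exists>n<m. (n \<in> set (snd (w ! i))) \<noteq> (n \<in> set (snd (w ! j)))"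
  shows "generic (\<lambda>x. x \<in> sat (cylinder U A w m) \<longrightarrow> length w \<le> level A (cylinder U A w m) x + 1)"
proof (rule level_translates[OF A cylinder_sets[OF U A]])
  let ?h = "\<lambda>i. enum (fst (w ! i))"
  have mem: "\<phi> (?h i) z \<in> A \<and> (\<forall>n<m. \<phi> (?h i) z \<in> U n \<longleftrightarrow> n \<in> set (snd (w ! i)))"
    if "i < length w" "z \<in> cylinder U A w m" for i z
    using that nth_mem[OF that(1)] unfolding cylinder_def by (auto simp: split_beta)
  show "?h i \<in> carrier G" for i by simp
  show "\<phi> (?h i) ` cylinder U A w m \<subseteq> A" if "i < length w" for i using mem[OF that] by blast
  show "\<phi> (?h i) ` cylinder U A w m \<inter> \<phi> (?h j) ` cylinder U A w m = {}"
    if ij: "i < length w" "j < length w" "i \<noteq> j" for i j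
  proof (rule ccontr)
    assume "\<phi> (?h i) ` cylinder U A w m \<inter> \<phi> (?h j) ` cylinder U A w m \<noteq> {}"
    then obtain y z where yz: "y \<in> cylinder U A w m" "z \<in> cylinder U A w m" "\<phi> (?h i) y = \<phi> (?h j) z" by blast
    then have "\<forall>n<m. n \<in> set (snd (w ! i)) \<longleftrightarrow> n \<in> set (snd (w ! j))"
      using mem[OF ij(1) yz(1)] mem[OF ij(2) yz(2)] by metis
    then show False using sep[OF ij] by blast
  qed
qed

text \<open>Choose \<open>t\<close> points of \<open>A\<close> in the orbit, a coordinate separating
  each ordered pair of distinct points, and \<open>m\<close> above all of these coordinates; the
  list records how \<open>x\<close> reaches the points and their true patterns.\<close>

lemma ex_cylinder:
  assumes x: "x \<in> \<Omega>" and inf: "infinite (A \<inter> orb x)"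
    and U: "\<And>y z. y \<in> \<Omega> \<Longrightarrow> z \<in> \<Omega> \<Longrightarrow> y \<noteq> z \<Longrightarrow> \<exists>n::nat. y \<in> U n \<and> z \<notin> U n"
  obtains w m where "length w = t" "x \<in> cylinder U A w m"
    "\<And>i j. i < length w \<Longrightarrow> j < length w \<Longrightarrow> i \<noteq> j \<Longrightarrow>
      \<exists>n<m. (n \<in> set (snd (w ! i))) \<noteq> (n \<in> set (snd (w ! j)))"
proof -
  obtain T where T: "T \<subseteq> A \<inter> orb x" "card T = t" "finite T"
    using infinite_arbitrarily_large[OF inf] by metis
  obtain ps where ps: "set ps = T" "distinct ps" using finite_distinct_list[OF T(3)] by blast
  then have len: "length ps = t" using T(2) distinct_card by metis
  have "\<exists>i. \<phi> (enum i) x = p" if "p \<in> T" for p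
  proof -
    have "p \<in> orb x" using T(1) that by blast
    then obtain g where "g \<in> carrier G" "p = \<phi> g x" by (rule orbE)
    then show ?thesis using enum_surj by metis
  qed
  then obtain a where a: "\<And>p. p \<in> T \<Longrightarrow> \<phi> (enum (a p)) x = p" by metis
  have T\<Omega>: "p \<in> \<Omega>" if "p \<in> T" for p using T(1) that orb_sub x by blast
  define s where "s p q = (SOME n. p \<in> U n \<and> q \<notin> U n)" for p q
  have s: "p \<in> U (s p q) \<and> q \<notin> U (s p q)" if "p \<in> T" "q \<in> T" "p \<noteq> q" for p q
    unfolding s_def by (rule someI_ex) (rule U[OF T\<Omega>[OF that(1)] T\<Omega>[OF that(2)] that(3)])
  have "finite ((\<lambda>(p, q). s p q) ` (T \<times> T))" using T(3) by simp
  then obtain m where m: "\<forall>n\<in>(\<lambda>(p, q). s p q) ` (T \<times> T). n < m"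
    using finite_nat_set_iff_bounded by auto
  let ?w = "map (\<lambda>p. (a p, filter (\<lambda>n. p \<in> U n) [0..<m])) ps"
  show thesis
  proof (rule that[of ?w m])
    show "length ?w = t" using len by simp
    show "x \<in> cylinder U A ?w m"
      unfolding cylinder_def using x a ps(1) T(1) by auto
    fix i j assume ij: "i < length ?w" "j < length ?w" "i \<noteq> j"
    then have "ps ! i \<in> T" "ps ! j \<in> T" "ps ! i \<noteq> ps ! j"
      using ps by (auto simp: nth_eq_iff_index_eq)
    then have "s (ps ! i) (ps ! j) < m" "ps ! i \<in> U (s (ps ! i) (ps ! j))" "ps ! j \<notin> U (s (ps ! i) (ps ! j))"
      using s m by auto
    then show "\<exists>n<m. (n \<in> set (snd (?w ! i))) \<noteq> (n \<in> set (snd (?w ! j)))"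
      using ij by (intro exI[of _ "s (ps ! i) (ps ! j)"]) simp
  qed
qed

text \<open>The order of choices is decisive. At a generic point the rules hold for all cylinders
  simultaneously, so the measuring set can be chosen after \<open>x\<close> and after the bound
  \<open>T x\<close>.\<close>

lemma negligible_of_traveling:
  assumes A: "A \<in> sets X" and cs: "complete_section G X \<phi> A" and tr: "lfin_traveling G X \<phi> A"
  shows "negligible \<Omega>"
proof -
  have sb: "standard_borel X" using space unfolding borel_G_space_def by simp
  obtain U :: "nat \<Rightarrow> 'a set" where U: "\<And>n. U n \<in> sets X"
    "\<And>y z. y \<in> \<Omega> \<Longrightarrow> z \<in> \<Omega> \<Longrightarrow> y \<noteq> z \<Longrightarrow> \<exists>n. y \<in> U n \<and> z \<notin> U n"
    by (rule standard_borel_countable_base[OF sb], rule that)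
  have satA: "x \<in> sat A" if "x \<in> \<Omega>" for x
    using cs that unfolding complete_section_def sat_def by blast
  obtain S :: "nat \<Rightarrow> 'a set" where S: "\<And>n. S n \<in> sets X" "disjoint_family S"
    "\<And>n. lfin_equidecomposable G X \<phi> A (S n)"
    using tr unfolding lfin_traveling_def by auto
  have ex: "\<exists>g P Q. (\<forall>k. g k \<in> carrier G) \<and> (\<forall>k::nat. P k \<in> sets X) \<and> (\<forall>k. Q k \<in> sets X) \<and>
    disjoint_family Q \<and> (\<Union>k. P k) = A \<and> (\<Union>k. Q k) = S n \<and> (\<forall>k. \<phi> (g k) ` P k = Q k) \<and>
    (\<forall>x\<in>A. finite {k. P k \<inter> orb x \<noteq> {}})" for n
    by (rule lfin_pieces[OF S(3)[of n]]) blast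
  then obtain g P Q where p: "\<And>n k. g n k \<in> carrier G" "\<And>n k::nat. P n k \<in> sets X" "\<And>n k. Q n k \<in> sets X"
    "\<And>n. disjoint_family (Q n)" "\<And>n. (\<Union>k. P n k) = A" "\<And>n. (\<Union>k. Q n k) = S n" "\<And>n k. \<phi> (g n k) ` P n k = Q n k"
    "\<And>n x. x \<in> A \<Longrightarrow> finite {k. P n k \<inter> orb x \<noteq> {}}"
    by metis
  have exb: "\<exists>b. A \<inter> orb x \<subseteq> (\<Union>k<b. P n k)" if x: "x \<in> \<Omega>" for n x
  proof -
    obtain y where y: "y \<in> orb x" "y \<in> A" using satA[OF x] unfolding sat_def by blast
    have "finite {k. P n k \<inter> orb x \<noteq> {}}" using p(8)[OF y(2)] orb_eq[OF y(1) x] by simp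
    then obtain b where b: "\<forall>k\<in>{k. P n k \<inter> orb x \<noteq> {}}. k < b"
      using finite_nat_set_iff_bounded by auto
    have "A \<inter> orb x \<subseteq> (\<Union>k<b. P n k)"
    proof
      fix z assume z: "z \<in> A \<inter> orb x"
      then obtain k where "z \<in> P n k" using p(5)[of n] by blast
      then show "z \<in> (\<Union>k<b. P n k)" using z b by blast
    qed
    then show ?thesis by blast
  qed
  \<comment> \<open>An arbitrary choice at each point suffices, since
    \<open>level_le_equidecomposed\<close> holds generically for all values of \<open>b\<close> at
    once.\<close>
  define b where "b n x = (SOME b. A \<inter> orb x \<subseteq> (\<Union>k<b. P n k))" for n x
  have b: "A \<inter> orb x \<subseteq> (\<Union>k<b n x. P n k)" if "x \<in> \<Omega>" for n x
    unfolding b_def by (rule someI_ex[OF exb[OF that]])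
  have eq: "generic (\<lambda>x. x \<in> sat F \<longrightarrow> level A F x \<le> level (S n) F x + (4 * b n x + 2))" if "F \<in> sets X" for n F
    by (rule generic_mono[OF level_le_equidecomposed[OF p(1,2,3,4,7) that, of n, unfolded p(5,6)]])
       (use b in fastforce)
  define T where "T x = 2 * level \<Omega> A x + 4 + (\<Sum>n<level \<Omega> A x + 2. 4 * b n x + 2)" for x
  have bound: "generic (\<lambda>x. x \<in> sat F \<longrightarrow> level A F x \<le> T x)" if "F \<in> sets X" for F
    unfolding T_def by (rule level_bounded[OF A satA S(1,2) eq that])
  let ?sep = "\<lambda>w m. \<forall>i<length w. \<forall>j<length w. i \<noteq> j \<longrightarrow>
      (\<exists>n<m. (n \<in> set (snd (w ! i))) \<noteq> (n \<in> set (snd (w ! j))))"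
  have "generic (\<lambda>x. \<forall>w::(nat \<times> nat list) list. \<forall>m. ?sep w m \<longrightarrow> x \<in> sat (cylinder U A w m) \<longrightarrow> length w \<le> level A (cylinder U A w m) x + 1)"
    by (intro generic_all generic_imp level_cylinder U A) blast
  moreover have "generic (\<lambda>x. \<forall>w::(nat \<times> nat list) list. \<forall>m. x \<in> sat (cylinder U A w m) \<longrightarrow> level A (cylinder U A w m) x \<le> T x)"
    by (intro generic_all bound cylinder_sets U A)
  moreover have "generic (\<lambda>x. x \<in> sat A \<longrightarrow> (\<exists>m. x \<notin> packed \<Omega> A m))"
    by (intro generic_level sets.top A)
  ultimately have "generic (\<lambda>x.
      (\<forall>w::(nat \<times> nat list) list. \<forall>m. ?sep w m \<longrightarrow> x \<in> sat (cylinder U A w m) \<longrightarrow> length w \<le> level A (cylinder U A w m) x + 1) \<and>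
      (\<forall>w::(nat \<times> nat list) list. \<forall>m. x \<in> sat (cylinder U A w m) \<longrightarrow> level A (cylinder U A w m) x \<le> T x) \<and>
      (x \<in> sat A \<longrightarrow> (\<exists>m. x \<notin> packed \<Omega> A m)))"
    by (intro generic_conj)
  then have "generic (\<lambda>x. False)"
  proof (rule generic_mono)
    fix x
    assume x: "x \<in> \<Omega>" and *: "(\<forall>w::(nat \<times> nat list) list. \<forall>m. ?sep w m \<longrightarrow> x \<in> sat (cylinder U A w m) \<longrightarrow> length w \<le> level A (cylinder U A w m) x + 1) \<and>
      (\<forall>w::(nat \<times> nat list) list. \<forall>m. x \<in> sat (cylinder U A w m) \<longrightarrow> level A (cylinder U A w m) x \<le> T x) \<and>
      (x \<in> sat A \<longrightarrow> (\<exists>m. x \<notin> packed \<Omega> A m))"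
    obtain k where k: "x \<notin> packed \<Omega> A k" using * satA[OF x] by blast
    \<comment> \<open>The equidecomposition carries a point of \<open>A\<close> into each
      \<open>S n\<close> within the orbit; as the \<open>S n\<close> are disjoint, the orbit is
      infinite.\<close>
    have meet: "S n \<inter> orb x \<noteq> {}" for n
    proof -
      obtain y where y: "y \<in> orb x" "y \<in> A" using satA[OF x] unfolding sat_def by blast
      then obtain k where k: "y \<in> P n k" using p(5)[of n] by blast
      have "\<phi> (g n k) y \<in> S n" using p(6)[of n] p(7)[of n k] k by blast
      moreover have "\<phi> (g n k) y \<in> orb x" using orb_act[OF p(1)[of n k], of y] orb_eq[OF y(1) x] by simp
      ultimately show ?thesis by blast
    qed
    have "infinite (orb x)"
    proof
      assume fin: "finite (orb x)"
      define f where "f n = (SOME y. y \<in> S n \<inter> orb x)" for n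
      have f: "f n \<in> S n \<inter> orb x" for n unfolding f_def some_in_eq by (rule meet)
      have "inj f"
      proof (rule injI)
        fix i j assume "f i = f j"
        then show "i = j" using f[of i] f[of j] S(2) unfolding disjoint_family_on_def by fastforce
      qed
      moreover have "range f \<subseteq> orb x" using f by blast
      ultimately show False using fin by (meson finite_imageD finite_subset infinite_UNIV_nat)
    qed
    then have "infinite (A \<inter> orb x)" by (rule infinite_section[OF x A k])
    \<comment> \<open>\<open>level_cylinder\<close> loses 1 and the level is at most
      \<open>T x\<close>, so \<open>T x + 2\<close> translates are just enough for a
      contradiction.\<close>
    then obtain w m where w: "length w = T x + 2" "x \<in> cylinder U A w m"
      "\<And>i j. i < length w \<Longrightarrow> j < length w \<Longrightarrow> i \<noteq> j \<Longrightarrow>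
        \<exists>n<m. (n \<in> set (snd (w ! i))) \<noteq> (n \<in> set (snd (w ! j)))"
      by (rule ex_cylinder[OF x _ U(2)]) blast+
    have xs: "x \<in> sat (cylinder U A w m)" using w(2) x orb_refl[OF x] unfolding sat_def by blast
    have "?sep w m" using w(3) by blast
    then have "length w \<le> level A (cylinder U A w m) x + 1" using * xs by blast
    moreover have "level A (cylinder U A w m) x \<le> T x" using * xs by blast
    ultimately show False using w(1) by simp
  qed
  then show ?thesis unfolding generic_def by simp
qed

end

theorem corollary6p5:
  fixes G :: "('g, 'm) monoid_scheme"
    and X :: "'a measure"
    and \<phi> :: "'g \<Rightarrow> 'a \<Rightarrow> 'a"
  assumes "group G"
    and "countable (carrier G)"
    and "infinite (carrier G)"
    and "borel_G_space G X \<phi>"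
    and "\<exists>A. A \<in> sets X \<and> complete_section G X \<phi> A \<and> lfin_traveling G X \<phi> A"
  shows "\<exists>P. generator G X \<phi> 32 P"
proof -
  interpret borel_action G X \<phi>
    using assms(1,2,4) by (rule borel_action.intro)
  obtain A where "A \<in> sets X" "complete_section G X \<phi> A" "lfin_traveling G X \<phi> A"
    using assms(5) by blast
  then have "negligible (space X)" by (rule negligible_of_traveling)
  then show ?thesis by (rule generator_of_negligible)
qed

end
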